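(* Let $\mu$ be a computable probability measure on the Cantor space $\Omega=\{0,1\}^{\mathbb{N}}$. Let $T:\Omega\to\Omega$ be a partial computable, $\mu$-almost everywhere defined, measure-preserving, ergodic transformation of $\Omega$. Let $A$ be an effectively open subset of $\Omega$ with $\mu(A)<1$. Let $A^*$ be the set of points $x\in\Omega$ such that $T^n(x)\in A$ for all $n\ge 0$. Then $A^*$ is an effectively null set (with respect to $\mu$).
   Context: For a finite binary string $x$, $x\Omega$ denotes the set of infinite binary sequences with prefix $x$. A set $U\subseteq\Omega$ is effectively open if there is a computably enumerable set $S$ of finite strings such that $U=\bigcup_{x\in S}x\Omega$. A probability measure $\mu$ on $\Omega$ is computable if $\mu(x\Omega)$ is a computable real uniformly in $x$. A set $N\subseteq\Omega$ is an effectively null set (w.r.t. $\mu$) if there is an algorithm that, given a rational $\varepsilon>0$, enumerates an effectively open set of $\mu$-measure at most $\varepsilon$ containing $N$. Computable transformation: a Turing machine with a read-only input tape (containing an infinite binary sequence) and a write-only one-way output tape determines a map from $\Omega$ to finite and infinite binary sequences; restricting it to the inputs for which the output is infinite gives a partial computable map $T$ from $\Omega$ to $\Omega$. It is almost everywhere defined if its domain has $\mu$-measure $1$. It is measure-preserving if $\mu(T^{-1}(B))=\mu(B)$ for every measurable $B$, and ergodic if every measurable $B$ that is invariant ($T^{-1}(B)=B$ up to a $\mu$-null set) has $\mu(B)\in\{0,1\}$. The condition "$T^n(x)\in A$" includes that $T^n(x)$ is defined. *)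

theory Defs
  imports "HOL-Probability.Probability" "HOL-Library.Nat_Bijection"
begin

section \<open>Computability on discrete data\<close>

definition minimize :: "(nat \<rightharpoonup> nat) \<Rightarrow> nat option" where
  "minimize h = (if \<exists>n. h n = Some 0 \<and> (\<forall>m<n. h m \<noteq> None)
                 then Some (LEAST n. h n = Some 0) else None)"

text \<open>Unary partial recursive functions; several arguments are passed as one number through the
  Cantor pairing.\<close>

inductive partrec :: "(nat \<rightharpoonup> nat) \<Rightarrow> bool" where
  zero: "partrec (\<lambda>_. Some 0)"
| succ: "partrec (\<lambda>n. Some (Suc n))"
| left: "partrec (\<lambda>n. Some (fst (prod_decode n)))"
| right: "partrec (\<lambda>n. Some (snd (prod_decode n)))"
| pair: "partrec f \<Longrightarrow> partrec g \<Longrightarrow>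
    partrec (\<lambda>n. Option.bind (f n) (\<lambda>a. Option.bind (g n) (\<lambda>b. Some (prod_encode (a, b)))))"
| comp: "partrec f \<Longrightarrow> partrec g \<Longrightarrow> partrec (\<lambda>n. Option.bind (g n) f)"
| prec: "partrec f \<Longrightarrow> partrec g \<Longrightarrow>
    partrec (\<lambda>n. case prod_decode n of (a, m) \<Rightarrow>
      rec_nat (f a) (\<lambda>k r. Option.bind r (\<lambda>b. g (prod_encode (a, prod_encode (k, b))))) m)"
| mu: "partrec f \<Longrightarrow> partrec (\<lambda>a. minimize (\<lambda>n. f (prod_encode (a, n))))"

text \<open>Fixed effective codings of finite objects by numbers.  (The library's \<open>to_nat\<close> for countable
  types is unsuitable here, since it is chosen nonconstructively.)\<close>

class coded =
  fixes encode :: "'a \<Rightarrow> nat"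
  assumes inj_encode: "inj encode"

instantiation nat :: coded
begin
definition encode_nat :: "nat \<Rightarrow> nat" where "encode_nat n = n"
instance by standard (simp add: encode_nat_def inj_def)
end

instantiation bool :: coded
begin
definition encode_bool :: "bool \<Rightarrow> nat" where "encode_bool b = of_bool b"
instance by standard (simp add: encode_bool_def inj_def)
end

instantiation prod :: (coded, coded) coded
begin
definition encode_prod :: "'a \<times> 'b \<Rightarrow> nat" where
  "encode_prod p = prod_encode (encode (fst p), encode (snd p))"
instance
  by standard (auto simp: encode_prod_def inj_def dest: injD[OF inj_encode])
end

instantiation list :: (coded) coded
begin
definition encode_list :: "'a list \<Rightarrow> nat" where
  "encode_list xs = list_encode (map encode xs)"
instance
proof
  show "inj (encode :: 'a list \<Rightarrow> nat)"
    by (rule injI) (simp only: encode_list_def list_encode_eq inj_map_eq_map[OF inj_encode])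
qed
end

instantiation option :: (coded) coded
begin
definition encode_option :: "'a option \<Rightarrow> nat" where
  "encode_option z = (case z of None \<Rightarrow> 0 | Some x \<Rightarrow> Suc (encode x))"
instance
  by standard (auto simp: encode_option_def inj_def split: option.splits dest: injD[OF inj_encode])
end

instantiation rat :: coded
begin
text \<open>Numerator and denominator in lowest terms.\<close>
definition encode_rat :: "rat \<Rightarrow> nat" where
  "encode_rat q = prod_encode (map_prod int_encode int_encode (quotient_of q))"
instance
proof
  show "inj (encode :: rat \<Rightarrow> nat)"
    unfolding encode_rat_def inj_def
    by (metis injD inj_int_encode inj_prod_encode prod.inj_map quotient_of_inject)
qed
end

definition computable :: "('a::coded \<Rightarrow> 'b::coded) \<Rightarrow> bool" where
  "computable f \<longleftrightarrow> (\<exists>g. partrec g \<and> (\<forall>x. g (encode x) = Some (encode (f x))))"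

text \<open>An enumeration algorithm outputs at most one element at each of its steps \<open>t\<close>; \<open>None\<close> means
  that nothing is output.\<close>

definition comp_enumerable :: "'a::coded set \<Rightarrow> bool" where
  "comp_enumerable S \<longleftrightarrow>
     (\<exists>f :: nat \<Rightarrow> 'a option. computable f \<and> S = {x. \<exists>t. f t = Some x})"

definition uniformly_comp_enumerable :: "('i::coded \<Rightarrow> 'a::coded set) \<Rightarrow> bool" where
  "uniformly_comp_enumerable S \<longleftrightarrow>
     (\<exists>f :: 'i \<times> nat \<Rightarrow> 'a option. computable f \<and> (\<forall>i. S i = {x. \<exists>t. f (i, t) = Some x}))"


section \<open>Effective notions on Cantor space\<close>

type_synonym cantor = "nat \<Rightarrow> bool"

definition cyl :: "bool list \<Rightarrow> cantor set" where
  "cyl x = {\<omega>. \<forall>i<length x. \<omega> i = x ! i}"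

definition effectively_open :: "cantor set \<Rightarrow> bool" where
  "effectively_open U \<longleftrightarrow> (\<exists>S. comp_enumerable S \<and> U = (\<Union>x\<in>S. cyl x))"

definition computable_measure :: "cantor measure \<Rightarrow> bool" where
  "computable_measure \<mu> \<longleftrightarrow>
     (\<exists>f :: bool list \<times> nat \<Rightarrow> rat. computable f \<and>
        (\<forall>x k. \<bar>measure \<mu> (cyl x) - of_rat (f (x, k))\<bar> \<le> 1 / 2 ^ k))"

definition effectively_null :: "cantor measure \<Rightarrow> cantor set \<Rightarrow> bool" where
  "effectively_null \<mu> N \<longleftrightarrow>
     (\<exists>S :: rat \<Rightarrow> bool list set. uniformly_comp_enumerable S \<and>
        (\<forall>\<epsilon>>0. N \<subseteq> (\<Union>x\<in>S \<epsilon>. cyl x) \<and> measure \<mu> (\<Union>x\<in>S \<epsilon>. cyl x) \<le> of_rat \<epsilon>))"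


section \<open>Turing machines transforming infinite sequences\<close>

datatype move = MoveLeft | Stay | MoveRight

text \<open>A machine is a finite table.  An entry \<open>((q, b, a), (q', a', d, e, z))\<close> applies in state
  \<open>q\<close> when the input head reads \<open>b\<close> and the work head reads \<open>a\<close>: the machine enters state \<open>q'\<close>,
  writes \<open>a'\<close> on the work tape, moves the input head by \<open>d\<close> and the work head by \<open>e\<close>, and
  appends the bit in \<open>z\<close>, if there is one, to the output.  The first applicable entry counts; if
  there is none, the machine halts.  State \<open>0\<close> is initial and work symbol \<open>0\<close> is the blank.\<close>

type_synonym machine =
  "((nat \<times> bool \<times> nat) \<times> (nat \<times> nat \<times> move \<times> move \<times> bool option)) list"

record config =
  state :: nat
  inhead :: nat
  work :: "int \<Rightarrow> nat"
  workhead :: int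
  out :: "bool list"

definition init_config :: config where
  "init_config = \<lparr>state = 0, inhead = 0, work = (\<lambda>_. 0), workhead = 0, out = []\<rparr>"

text \<open>The input tape is infinite to the right only: moving left from its first cell has no effect.\<close>

fun move_in :: "move \<Rightarrow> nat \<Rightarrow> nat" where
  "move_in MoveLeft i = i - 1"
| "move_in Stay i = i"
| "move_in MoveRight i = i + 1"

fun move_work :: "move \<Rightarrow> int \<Rightarrow> int" where
  "move_work MoveLeft j = j - 1"
| "move_work Stay j = j"
| "move_work MoveRight j = j + 1"

definition step :: "machine \<Rightarrow> cantor \<Rightarrow> config \<Rightarrow> config" where
  "step M \<omega> c =
     (case map_of M (state c, \<omega> (inhead c), work c (workhead c)) of
        None \<Rightarrow> c
      | Some (q, a, d, e, z) \<Rightarrow>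
          \<lparr>state = q, inhead = move_in d (inhead c),
           work = (work c)(workhead c := a), workhead = move_work e (workhead c),
           out = out c @ (case z of None \<Rightarrow> [] | Some b \<Rightarrow> [b])\<rparr>)"

definition output_at :: "machine \<Rightarrow> cantor \<Rightarrow> nat \<Rightarrow> bool list" where
  "output_at M \<omega> t = out ((step M \<omega> ^^ t) init_config)"

definition outputs :: "machine \<Rightarrow> cantor \<Rightarrow> cantor \<Rightarrow> bool" where
  "outputs M \<omega> \<eta> \<longleftrightarrow>
     (\<forall>t. \<eta> \<in> cyl (output_at M \<omega> t)) \<and> (\<forall>n. \<exists>t. n \<le> length (output_at M \<omega> t))"

definition partial_computable :: "(cantor \<rightharpoonup> cantor) \<Rightarrow> bool" where
  "partial_computable T \<longleftrightarrow> (\<exists>M. \<forall>\<omega> \<eta>. T \<omega> = Some \<eta> \<longleftrightarrow> outputs M \<omega> \<eta>)"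


section \<open>Dynamics of partial maps\<close>

definition pre :: "('a \<rightharpoonup> 'a) \<Rightarrow> 'a set \<Rightarrow> 'a set" where
  "pre T B = T -` Some ` B"

definition ae_defined :: "'a measure \<Rightarrow> ('a \<rightharpoonup> 'a) \<Rightarrow> bool" where
  "ae_defined \<mu> T \<longleftrightarrow> dom T \<in> sets \<mu> \<and> measure \<mu> (dom T) = 1"

definition measure_preserving :: "'a measure \<Rightarrow> ('a \<rightharpoonup> 'a) \<Rightarrow> bool" where
  "measure_preserving \<mu> T \<longleftrightarrow>
     (\<forall>B\<in>sets \<mu>. pre T B \<in> sets \<mu> \<and> measure \<mu> (pre T B) = measure \<mu> B)"

definition ergodic :: "'a measure \<Rightarrow> ('a \<rightharpoonup> 'a) \<Rightarrow> bool" where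
  "ergodic \<mu> T \<longleftrightarrow>
     (\<forall>B\<in>sets \<mu>. (pre T B - B) \<union> (B - pre T B) \<in> null_sets \<mu> \<longrightarrow> measure \<mu> B \<in> {0, 1})"

primrec iterate :: "('a \<rightharpoonup> 'a) \<Rightarrow> nat \<Rightarrow> ('a \<rightharpoonup> 'a)" where
  "iterate T 0 = Some"
| "iterate T (Suc n) = (\<lambda>x. Option.bind (iterate T n x) T)"

definition always_in :: "('a \<rightharpoonup> 'a) \<Rightarrow> 'a set \<Rightarrow> 'a set" where
  "always_in T A = {x. \<forall>n. \<exists>y\<in>A. iterate T n x = Some y}"

end

(* Let J be a cylinder and N a number of steps after which the frequency of visits to J is close to
   mu(J) outside a set of measure at most 1/2^e.  Since
     mu(J \<inter> T^-n A) = mu(T^-(N-1-n) J \<inter> T^-(N-1) A),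
   averaging over n < N gives some n < N with mu(J \<inter> T^-n A) <= mu(J) mu(A) + O(1/2^e), whatever A is.
   Hence J may be replaced by the effectively open set of points of J whose first N iterates lie in A:
   this keeps all of A* \<inter> J and shrinks the measure by a factor mu(A) < 1 up to a small error.  The
   number N depends on J only, it exists by the ergodic theorem, and a finite computation with
   approximations of mu can certify it, although mu(A) itself is not computable.  Iterating, and
   summing the errors over the disjoint cylinders of each level, makes the cover as small as desired. *)

theory Submission
  imports Defs "HOL-Library.Sublist"
begin

section \<open>Recursive functions of numbers\<close>

text \<open>The ergodic theorem comes without a computable rate, so \<open>N\<close> is searched
  for, and the search needs a decidable criterion. This is why measures enter only as finite sums of
  approximations over strings of one length, and why visits are overcounted from finite inputs: the
  overcount makes a passed test trustworthy, and its effect dies out as the inputs grow, so that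
  some test passes. Only the upper tail of the visit frequency enters, and the maximal ergodic
  inequality controls it. A cylinder \<open>y\<close> is treated with precision
  \<open>str_code y + E\<close>; the codes are distinct, so even an infinite level costs at most
  \<open>20 / 2 ^ E\<close>, and \<open>k\<close> levels leave mass at most
  \<open>prob A ^ k + k * (20 / 2 ^ E)\<close>. The measure of \<open>A\<close> influences the
  algorithm only through one fixed exponent \<open>C\<close> with \<open>prob A ^ C < 1 / 2\<close>.
  Each level is a prefix-free set given by a stopping rule, hence decidable, and this makes the
  enumeration uniform.\<close>

definition recursive :: "(nat \<Rightarrow> nat) \<Rightarrow> bool" where
  "recursive f \<longleftrightarrow> partrec (\<lambda>n. Some (f n))"

definition decidable :: "(nat \<Rightarrow> bool) \<Rightarrow> bool" where
  "decidable P \<longleftrightarrow> recursive (\<lambda>n. of_bool (P n))"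

abbreviation p1 :: "nat \<Rightarrow> nat" where "p1 n \<equiv> fst (prod_decode n)"
abbreviation p2 :: "nat \<Rightarrow> nat" where "p2 n \<equiv> snd (prod_decode n)"

named_theorems recursive_intros

lemma recursive_comp: "recursive f \<Longrightarrow> recursive g \<Longrightarrow> recursive (\<lambda>n. f (g n))"
  unfolding recursive_def using partrec.comp[of "\<lambda>n. Some (f n)" "\<lambda>n. Some (g n)"] by simp

lemma recursive_pair [recursive_intros]:
  "recursive f \<Longrightarrow> recursive g \<Longrightarrow> recursive (\<lambda>n. prod_encode (f n, g n))"
  unfolding recursive_def using partrec.pair[of "\<lambda>n. Some (f n)" "\<lambda>n. Some (g n)"] by simp

lemma recursive_p1 [recursive_intros]: "recursive f \<Longrightarrow> recursive (\<lambda>n. p1 (f n))"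
  by (rule recursive_comp) (simp_all add: recursive_def partrec.left)

lemma recursive_p2 [recursive_intros]: "recursive f \<Longrightarrow> recursive (\<lambda>n. p2 (f n))"
  by (rule recursive_comp) (simp_all add: recursive_def partrec.right)

lemma recursive_Suc [recursive_intros]: "recursive f \<Longrightarrow> recursive (\<lambda>n. Suc (f n))"
  by (rule recursive_comp) (simp_all add: recursive_def partrec.succ)

lemma recursive_id [recursive_intros]: "recursive (\<lambda>n. n)"
  using recursive_pair[of p1 p2] recursive_p1[of "\<lambda>n. n"] recursive_p2[of "\<lambda>n. n"]
  by (simp add: recursive_def partrec.left partrec.right)

lemma recursive_const [recursive_intros]: "recursive (\<lambda>n. c)"
  by (induction c) (auto simp: recursive_def partrec.zero intro: recursive_Suc[unfolded recursive_def])

text \<open>All of \<open>n\<close> is handed to \<open>partrec.prec\<close> as the parameter, so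
  that base and step of the recursion may depend on it; on total data the option bindings
  collapse.\<close>

lemma recursive_rec_nat:
  assumes "recursive f" and "recursive m"
    and "recursive (\<lambda>z. g (p1 z) (p1 (p2 z)) (p2 (p2 z)))"
  shows "recursive (\<lambda>n. rec_nat (f n) (g n) (m n))"
proof -
  let ?g = "\<lambda>z. g (p1 z) (p1 (p2 z)) (p2 (p2 z))"
  have eq: "rec_nat (Some (f a)) (\<lambda>k r. Option.bind r
        (\<lambda>b. Some (?g (prod_encode (a, prod_encode (k, b)))))) m = Some (rec_nat (f a) (g a) m)"
    for a m by (induction m) auto
  have "recursive (\<lambda>n. rec_nat (f (p1 n)) (g (p1 n)) (p2 n))"
    using partrec.prec[of "\<lambda>n. Some (f n)" "\<lambda>n. Some (?g n)"] assms(1,3)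
    unfolding recursive_def by (simp only: eq case_prod_beta)
  from recursive_comp[OF this, of "\<lambda>n. prod_encode (n, m n)"] assms(2) show ?thesis
    by (simp add: recursive_pair recursive_id)
qed

lemma recursive_Least:
  assumes "decidable (\<lambda>z. P (p1 z) (p2 z))" and "\<And>n. \<exists>m. P n m"
  shows "recursive (\<lambda>n. LEAST m. P n m)"
proof -
  \<comment> \<open>\<open>minimize\<close> searches for a zero, so the truth value is negated. The
    recursion swaps 0 and 1; subtraction is shown recursive only later.\<close>
  have "recursive (\<lambda>z. rec_nat 1 (\<lambda>_ _. 0) (of_bool (P (p1 z) (p2 z))))"
    using assms(1) by (intro recursive_rec_nat recursive_intros) (simp_all add: decidable_def)
  then have "partrec (\<lambda>a. minimize (\<lambda>n. Some (rec_nat 1 (\<lambda>_ _. 0) (of_bool (P a n)))))"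
    unfolding recursive_def by (drule_tac partrec.mu) simp
  moreover have "rec_nat (1::nat) (\<lambda>_ _. 0) (of_bool Q) = 0 \<longleftrightarrow> Q" for Q
    by (cases Q) auto
  ultimately show ?thesis
    using assms(2) by (simp add: recursive_def minimize_def)
qed

section \<open>Arithmetic, decidable predicates and bounded quantifiers\<close>

lemma recursive_add [recursive_intros]:
  assumes "recursive f" "recursive g" shows "recursive (\<lambda>n. f n + g n)"
proof -
  have "rec_nat a (\<lambda>k b. Suc b) m = a + m" for a m by (induction m) auto
  with recursive_rec_nat[OF assms, of "\<lambda>_ _ b. Suc b"] show ?thesis
    by (simp add: recursive_intros)
qed

lemma recursive_diff [recursive_intros]:
  assumes "recursive f" "recursive g" shows "recursive (\<lambda>n. f n - g n)"
proof -
  have "rec_nat 0 (\<lambda>k b. k) m = m - 1" for m by (cases m) auto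
  with recursive_rec_nat[of "\<lambda>_. 0" "\<lambda>n. n" "\<lambda>_ k _. k"]
  have pred: "recursive (\<lambda>n. n - 1)"
    by (simp add: recursive_intros)
  have "rec_nat a (\<lambda>k b. b - 1) m = a - m" for a m by (induction m) auto
  with recursive_rec_nat[OF assms, of "\<lambda>_ _ b. b - 1"] recursive_comp[OF pred, of "\<lambda>z. p2 (p2 z)"]
  show ?thesis by (simp add: recursive_intros)
qed

lemma recursive_mult [recursive_intros]:
  assumes "recursive f" "recursive g" shows "recursive (\<lambda>n. f n * g n)"
proof -
  have "rec_nat 0 (\<lambda>k b. a + b) m = a * m" for a m by (induction m) auto
  with recursive_rec_nat[OF _ assms(2), of "\<lambda>_. 0" "\<lambda>n _ b. f n + b"]
    recursive_comp[OF assms(1), of p1]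
  show ?thesis by (simp add: recursive_intros)
qed

lemma recursive_power [recursive_intros]:
  assumes "recursive f" "recursive g" shows "recursive (\<lambda>n. f n ^ g n)"
proof -
  have "rec_nat 1 (\<lambda>k b. a * b) m = a ^ m" for a m :: nat by (induction m) auto
  with recursive_rec_nat[OF _ assms(2), of "\<lambda>_. 1" "\<lambda>n _ b. f n * b"]
    recursive_comp[OF assms(1), of p1]
  show ?thesis by (simp add: recursive_intros)
qed

lemma recursive_sum [recursive_intros]:
  assumes "recursive m" "recursive (\<lambda>z. f (p1 z) (p2 z))"
  shows "recursive (\<lambda>n. \<Sum>i<m n. f n i)"
proof -
  have "rec_nat 0 (\<lambda>k b. b + f n k) j = (\<Sum>i<j. f n i)" for n j by (induction j) auto
  with recursive_rec_nat[OF _ assms(1), of "\<lambda>_. 0" "\<lambda>n k b. b + f n k"]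
    recursive_comp[OF assms(2), of "\<lambda>z. prod_encode (p1 z, p1 (p2 z))"]
  show ?thesis by (simp add: recursive_intros)
qed

lemma recursive_of_bool [recursive_intros]: "decidable P \<Longrightarrow> recursive (\<lambda>n. of_bool (P n))"
  by (simp add: decidable_def)

lemma decidable_const [recursive_intros]: "decidable (\<lambda>n. b)"
  unfolding decidable_def by (rule recursive_const)

lemma decidable_le [recursive_intros]:
  assumes "recursive f" "recursive g" shows "decidable (\<lambda>n. f n \<le> g n)"
proof -
  have "of_bool (f n \<le> g n) = 1 - (f n - g n)" for n by auto
  then show ?thesis unfolding decidable_def using assms by (simp add: recursive_intros)
qed

lemma decidable_less [recursive_intros]:
  "recursive f \<Longrightarrow> recursive g \<Longrightarrow> decidable (\<lambda>n. f n < g n)"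
  unfolding less_eq_Suc_le by (intro recursive_intros)

lemma decidable_not [recursive_intros]:
  assumes "decidable P" shows "decidable (\<lambda>n. \<not> P n)"
proof -
  have "of_bool (\<not> P n) = 1 - (of_bool (P n) :: nat)" for n by auto
  then show ?thesis unfolding decidable_def using assms by (simp add: recursive_intros)
qed

lemma decidable_conj [recursive_intros]:
  assumes "decidable P" "decidable Q" shows "decidable (\<lambda>n. P n \<and> Q n)"
proof -
  have "of_bool (P n \<and> Q n) = of_bool (P n) * (of_bool (Q n) :: nat)" for n by auto
  then show ?thesis unfolding decidable_def using assms by (simp add: recursive_intros)
qed

lemma decidable_disj [recursive_intros]:
  assumes "decidable P" "decidable Q" shows "decidable (\<lambda>n. P n \<or> Q n)"
  using decidable_not[OF decidable_conj[OF decidable_not[OF assms(1)] decidable_not[OF assms(2)]]]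
  by simp

lemma decidable_eq [recursive_intros]:
  "recursive f \<Longrightarrow> recursive g \<Longrightarrow> decidable (\<lambda>n. f n = g n)"
  using decidable_conj[of "\<lambda>n. f n \<le> g n" "\<lambda>n. g n \<le> f n"] by (simp add: recursive_intros eq_iff)

lemma decidable_iff [recursive_intros]:
  assumes "decidable P" "decidable Q" shows "decidable (\<lambda>n. P n \<longleftrightarrow> Q n)"
proof -
  have "(P n \<longleftrightarrow> Q n) \<longleftrightarrow> of_bool (P n) = (of_bool (Q n) :: nat)" for n by simp
  then show ?thesis using assms by (simp only:) (intro recursive_intros)
qed

lemma recursive_if [recursive_intros]:
  assumes "decidable P" "recursive f" "recursive g"
  shows "recursive (\<lambda>n. if P n then f n else g n)"
proof -
  have "(if P n then f n else g n) = of_bool (P n) * f n + of_bool (\<not> P n) * g n" for n by auto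
  then show ?thesis using assms by (simp add: recursive_intros)
qed

lemma decidable_ex_less [recursive_intros]:
  assumes "recursive m" "decidable (\<lambda>z. P (p1 z) (p2 z))"
  shows "decidable (\<lambda>n. \<exists>i<m n. P n i)"
proof -
  have "(\<exists>i<j. P n i) \<longleftrightarrow> 0 < (\<Sum>i<j. of_bool (P n i) :: nat)" for n j
    by (auto simp: card_gt_0_iff)
  then show ?thesis using assms by (simp only:) (intro recursive_intros)
qed

lemma decidable_ex_le [recursive_intros]:
  "recursive m \<Longrightarrow> decidable (\<lambda>z. P (p1 z) (p2 z)) \<Longrightarrow> decidable (\<lambda>n. \<exists>i\<le>m n. P n i)"
  unfolding less_Suc_eq_le[symmetric] by (intro recursive_intros)

lemma decidable_all_less [recursive_intros]:
  assumes "recursive m" "decidable (\<lambda>z. P (p1 z) (p2 z))"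
  shows "decidable (\<lambda>n. \<forall>i<m n. P n i)"
  using decidable_not[OF decidable_ex_less[OF assms(1) decidable_not[OF assms(2)]]] by simp

lemma recursive_div [recursive_intros]:
  assumes "recursive f" "recursive g" shows "recursive (\<lambda>n. f n div g n)"
proof -
  \<comment> \<open>The quotient counts the positive multiples of \<open>b\<close> up to
    \<open>a\<close>; the conjunct \<open>0 < b\<close> reproduces the convention
    \<open>a div 0 = 0\<close>.\<close>
  have "a div b = (\<Sum>i<a. of_bool (0 < b \<and> Suc i * b \<le> a))" for a b :: nat
  proof (cases "b = 0")
    case False
    then have "0 < b \<and> Suc i * b \<le> a \<longleftrightarrow> i < a div b" for i
      by (metis Suc_le_eq less_eq_div_iff_mult_less_eq gr0I)
    then have "(\<Sum>i<a. of_bool (0 < b \<and> Suc i * b \<le> a)) = (\<Sum>i<a. of_bool (i < a div b) :: nat)"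
      by (simp only:)
    also have "(\<Sum>i<j. of_bool (i < c)) = min j c" for j c :: nat
      by (induction j) auto
    finally show ?thesis by simp
  qed simp
  moreover have "recursive (\<lambda>n. \<Sum>i<f n. of_bool (0 < g n \<and> Suc i * g n \<le> f n))"
    using recursive_comp[OF assms(1), of p1] recursive_comp[OF assms(2), of p1] assms
    by (intro recursive_intros) (simp_all add: recursive_intros)
  ultimately show ?thesis by simp
qed

lemma recursive_mod [recursive_intros]:
  "recursive f \<Longrightarrow> recursive g \<Longrightarrow> recursive (\<lambda>n. f n mod g n)"
  unfolding minus_mult_div_eq_mod[symmetric] by (intro recursive_intros)

lemma decidable_bit [recursive_intros]:
  assumes "recursive f" "recursive g" shows "decidable (\<lambda>n. bit (f n) (g n))"
proof -
  have "bit (f n) (g n) \<longleftrightarrow> f n div 2 ^ g n mod 2 = 1" for n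
    by (simp add: bit_iff_odd odd_iff_mod_2_eq_one)
  then show ?thesis using assms by (simp add: recursive_intros)
qed

section \<open>Recursive functions of binary strings\<close>

text \<open>A string is coded by its length and the number whose binary digits it lists, least
  significant digit first; the coding \<open>encode\<close> is only used for input and output.\<close>

definition str_code :: "bool list \<Rightarrow> nat" where
  "str_code x = prod_encode (length x, horner_sum of_bool 2 x)"

definition str_decode :: "nat \<Rightarrow> bool list" where
  "str_decode n = map (bit (p2 n)) [0..<p1 n]"

definition string_recursive :: "(nat \<Rightarrow> bool list) \<Rightarrow> bool" where
  "string_recursive f \<longleftrightarrow> recursive (\<lambda>n. str_code (f n))"

definition ext :: "bool list \<Rightarrow> cantor" where
  "ext x = (\<lambda>i. i < length x \<and> x ! i)"

lemma p1_str_code [simp]: "p1 (str_code x) = length x"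
  by (simp add: str_code_def)

lemma bit_str_code [simp]: "bit (p2 (str_code x)) i \<longleftrightarrow> ext x i"
  by (simp add: str_code_def ext_def bit_horner_sum_bit_iff)

lemma str_decode_str_code [simp]: "str_decode (str_code x) = x"
  by (rule nth_equalityI) (simp_all add: str_decode_def ext_def)

lemma inj_str_code: "inj str_code"
  by (rule inj_on_inverseI[of _ str_decode]) simp

lemma str_code_str_decode: "str_code (str_decode n) = prod_encode (p1 n, p2 n mod 2 ^ p1 n)"
  by (simp add: str_code_def str_decode_def horner_sum_bit_eq_take_bit take_bit_eq_mod)

lemma recursive_of_string:
  "recursive (\<lambda>n. F (str_decode n)) \<Longrightarrow> string_recursive f \<Longrightarrow> recursive (\<lambda>n. F (f n))"
  using recursive_comp[of "\<lambda>n. F (str_decode n)" "\<lambda>n. str_code (f n)"]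
  by (simp add: string_recursive_def)

lemma string_recursive_of_string:
  "string_recursive (\<lambda>n. F (str_decode n)) \<Longrightarrow> string_recursive f \<Longrightarrow> string_recursive (\<lambda>n. F (f n))"
  using recursive_of_string[of "\<lambda>x. str_code (F x)"] by (simp add: string_recursive_def)

lemma recursive_str_code [recursive_intros]:
  "string_recursive f \<Longrightarrow> recursive (\<lambda>n. str_code (f n))"
  by (simp add: string_recursive_def)

lemma string_recursive_str_decode [recursive_intros]:
  "recursive f \<Longrightarrow> string_recursive (\<lambda>n. str_decode (f n))"
  unfolding string_recursive_def str_code_str_decode by (intro recursive_intros)

lemma recursive_length [recursive_intros]:
  "string_recursive f \<Longrightarrow> recursive (\<lambda>n. length (f n))"
  using recursive_p1[of "\<lambda>n. str_code (f n)"] by (simp add: string_recursive_def)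

lemma decidable_ext [recursive_intros]:
  "string_recursive f \<Longrightarrow> recursive g \<Longrightarrow> decidable (\<lambda>n. ext (f n) (g n))"
  using decidable_bit[OF recursive_p2, of "\<lambda>n. str_code (f n)" g] by (simp add: recursive_intros)

lemma string_recursive_take [recursive_intros]:
  assumes "recursive g" "string_recursive f"
  shows "string_recursive (\<lambda>n. take (g n) (f n))"
proof -
  have "take k x = str_decode (prod_encode (if length x \<le> k then length x else k, p2 (str_code x)))"
    for k and x :: "bool list"
    by (rule nth_equalityI) (auto simp: str_decode_def ext_def)
  then show ?thesis using assms by (simp only:) (intro recursive_intros)
qed

lemma string_recursive_snoc [recursive_intros]:
  assumes "string_recursive f" shows "string_recursive (\<lambda>n. f n @ [b])"
proof -
  have "str_code (x @ [b]) = prod_encode (Suc (length x), p2 (str_code x) + 2 ^ length x * of_bool b)" for x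
    by (simp add: str_code_def horner_sum_append)
  then show ?thesis using assms unfolding string_recursive_def
    by (simp only:) (intro recursive_intros, simp_all add: string_recursive_def)
qed

lemma decidable_string_eq [recursive_intros]:
  assumes "string_recursive f" "string_recursive g"
  shows "decidable (\<lambda>n. f n = g n)"
  using decidable_eq[of "\<lambda>n. str_code (f n)" "\<lambda>n. str_code (g n)"] assms
  by (simp add: string_recursive_def inj_eq[OF inj_str_code])

lemma recursive_encode [recursive_intros]:
  assumes "string_recursive f"
  shows "recursive (\<lambda>n. encode (f n))"
proof -
  \<comment> \<open>\<open>list_encode\<close> nests from the head of the list, so the recursion
    starts at the last bit: after \<open>k\<close> rounds it holds the code of the last
    \<open>k\<close> bits.\<close>
  define h where "h x = rec_nat 0 (\<lambda>k b. Suc (prod_encode (of_bool (ext x (length x - Suc k)), b)))"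
    for x
  have "h x k = list_encode (map encode (drop (length x - k) x))" if "k \<le> length x" for x k
    using that
  proof (induction k)
    case (Suc k)
    let ?i = "length x - Suc k"
    have "Suc ?i = length x - k" and "?i < length x" using Suc.prems by auto
    then have "drop ?i x = x ! ?i # drop (length x - k) x"
      by (metis Cons_nth_drop_Suc)
    with Suc \<open>?i < length x\<close> show ?case
      by (simp add: h_def ext_def encode_bool_def)
  qed (simp add: h_def)
  from this[OF order_refl] have "h x (length x) = encode x" for x
    by (simp add: encode_list_def)
  moreover have "recursive (\<lambda>n. h (f n) (length (f n)))"
    using assms recursive_comp[OF recursive_str_code[OF assms], of p1] unfolding h_def
    by (intro recursive_rec_nat recursive_intros) (simp_all add: recursive_intros string_recursive_def)
  ultimately show ?thesis by simp
qed

lemma string_recursive_funpow: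
  assumes F: "string_recursive (\<lambda>n. F (str_decode n))"
    and "string_recursive f" "recursive g"
  shows "string_recursive (\<lambda>n. (F ^^ g n) (f n))"
proof -
  have "str_code ((F ^^ k) x) = rec_nat (str_code x) (\<lambda>_ u. str_code (F (str_decode u))) k" for k x
    by (induction k) (simp, metis comp_apply funpow.simps(2) old.nat.simps(7) str_decode_str_code)
  moreover have "string_recursive (\<lambda>z. F (str_decode (p2 (p2 z))))"
    by (rule string_recursive_of_string[OF F]) (intro recursive_intros)
  ultimately show ?thesis
    using assms unfolding string_recursive_def by (simp add: recursive_rec_nat)
qed

section \<open>Machines on finite inputs\<close>

definition prefix_of :: "cantor \<Rightarrow> nat \<Rightarrow> bool list" where
  "prefix_of \<omega> n = map \<omega> [0..<n]"

text \<open>With as many steps as input bits, only bits of \<open>x\<close> are read and never the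
  padding of \<open>ext x\<close>, so the result is valid for every infinite input extending
  \<open>x\<close>.\<close>

definition run :: "machine \<Rightarrow> bool list \<Rightarrow> bool list" where
  "run M x = output_at M (ext x) (length x)"

lemma length_prefix_of [simp]: "length (prefix_of \<omega> n) = n"
  by (simp add: prefix_of_def)

lemma nth_prefix_of [simp]: "i < n \<Longrightarrow> prefix_of \<omega> n ! i = \<omega> i"
  by (simp add: prefix_of_def)

lemma prefix_of_eq_iff: "prefix_of \<omega> (length x) = x \<longleftrightarrow> \<omega> \<in> cyl x"
  by (subst list_eq_iff_nth_eq) (simp add: cyl_def)

lemma take_prefix_of [simp]: "take m (prefix_of \<omega> n) = prefix_of \<omega> (min m n)"
  by (simp add: prefix_of_def take_map min_def)

lemma prefix_iff_take: "prefix x y \<longleftrightarrow> take (length x) y = x"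
  using take_is_prefix[of "length x" y] by (auto simp: prefix_def)

lemma prefix_prefix_of: "prefix x (prefix_of \<omega> n) \<longleftrightarrow> length x \<le> n \<and> \<omega> \<in> cyl x"
proof (cases "length x \<le> n")
  case True
  then show ?thesis by (simp add: prefix_iff_take min_def prefix_of_eq_iff)
next
  case False
  then show ?thesis using prefix_length_le[of x "prefix_of \<omega> n"] by auto
qed

lemma in_cyl_prefix_of [simp]: "\<omega> \<in> cyl (prefix_of \<omega> n)"
  by (simp add: cyl_def)

lemma cyl_antimono: "prefix x y \<Longrightarrow> cyl y \<subseteq> cyl x"
proof
  fix \<omega> assume xy: "prefix x y" and "\<omega> \<in> cyl y"
  then have "prefix_of \<omega> (length y) = y" by (simp only: prefix_of_eq_iff)
  with xy have "prefix x (prefix_of \<omega> (length y))" by simp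
  then show "\<omega> \<in> cyl x" by (simp add: prefix_prefix_of)
qed

section \<open>Locality and monotonicity of computations\<close>

lemma inhead_step_le: "inhead (step M \<omega> c) \<le> Suc (inhead c)"
proof -
  have "move_in d i \<le> Suc i" for d i by (cases d) simp_all
  then show ?thesis by (auto simp: step_def split: option.split)
qed

lemma inhead_le: "inhead ((step M \<omega> ^^ t) init_config) \<le> t"
proof (induction t)
  case (Suc t)
  then show ?case
    using inhead_step_le[of M \<omega> "(step M \<omega> ^^ t) init_config"] by simp
qed (simp add: init_config_def)

lemma step_cong: "\<omega> (inhead c) = \<omega>' (inhead c) \<Longrightarrow> step M \<omega> c = step M \<omega>' c"
  by (simp add: step_def)

lemma prefix_out_step: "prefix (out c) (out (step M \<omega> c))"
  by (auto simp: step_def split: option.split)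

text \<open>After \<open>i\<close> steps the input head stands at cell \<open>i\<close> or further
  left, so the first \<open>t\<close> steps read only cells below \<open>t\<close>.\<close>

lemma step_funpow_cong:
  assumes "\<And>i. i < t \<Longrightarrow> \<omega> i = \<omega>' i"
  shows "(step M \<omega> ^^ t) init_config = (step M \<omega>' ^^ t) init_config"
  using assms
proof (induction t)
  case (Suc t)
  then have "(step M \<omega> ^^ t) init_config = (step M \<omega>' ^^ t) init_config" by simp
  moreover have "\<omega> (inhead ((step M \<omega>' ^^ t) init_config)) = \<omega>' (inhead ((step M \<omega>' ^^ t) init_config))"
    using inhead_le[where M = M and \<omega> = \<omega>' and t = t] by (intro Suc.prems) simp
  ultimately show ?case by (simp add: step_cong[where \<omega> = \<omega> and \<omega>' = \<omega>'])
qed simp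

lemma output_at_mono: "s \<le> t \<Longrightarrow> prefix (output_at M \<omega> s) (output_at M \<omega> t)"
proof (induction t rule: dec_induct)
  case (step t)
  have "prefix (output_at M \<omega> t) (output_at M \<omega> (Suc t))"
    by (simp add: output_at_def prefix_out_step)
  with step.IH show ?case by (rule prefix_order.trans)
qed simp

lemma run_prefix_of: "run M (prefix_of \<omega> n) = output_at M \<omega> n"
proof -
  have "(step M (ext (prefix_of \<omega> n)) ^^ n) init_config = (step M \<omega> ^^ n) init_config"
    by (rule step_funpow_cong) (simp add: ext_def)
  then show ?thesis by (simp add: run_def output_at_def)
qed

lemma run_mono: "prefix x y \<Longrightarrow> prefix (run M x) (run M y)"
proof -
  assume xy: "prefix x y"
  then have eq: "prefix_of (ext y) (length x) = x"
    by (intro nth_equalityI) (auto simp: ext_def prefix_def nth_append)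
  then have "run M x = output_at M (ext y) (length x)"
    using run_prefix_of[of M "ext y" "length x"] by (simp add: eq)
  with xy show ?thesis by (simp add: run_def output_at_mono prefix_length_le)
qed

lemma funpow_run_mono: "prefix x y \<Longrightarrow> prefix ((run M ^^ n) x) ((run M ^^ n) y)"
  by (induction n) (simp_all add: run_mono)

text \<open>On a known prefix of the previous iterate \<open>\<zeta>\<close>, the machine reproduces
  its output on \<open>\<zeta>\<close> at the time given by the length of that prefix. These
  prefixes become arbitrarily long by induction, and hence so do the outputs.\<close>

lemma iterate_approx:
  assumes T: "\<And>\<omega> \<eta>. T \<omega> = Some \<eta> \<longleftrightarrow> outputs M \<omega> \<eta>" and "iterate T n \<omega> = Some \<eta>"
  shows "\<eta> \<in> cyl ((run M ^^ n) (prefix_of \<omega> l)) \<and> (\<exists>l. m \<le> length ((run M ^^ n) (prefix_of \<omega> l)))"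
  using assms(2)
proof (induction n arbitrary: \<eta> l m)
  case 0
  then show ?case by (auto intro: exI[of _ m])
next
  case (Suc n)
  then obtain \<zeta> where \<zeta>: "iterate T n \<omega> = Some \<zeta>" and "outputs M \<zeta> \<eta>"
    by (auto simp: T bind_eq_Some_conv)
  have run_eq: "(run M ^^ Suc n) (prefix_of \<omega> l) = output_at M \<zeta> (length ((run M ^^ n) (prefix_of \<omega> l)))" for l
  proof -
    have "\<zeta> \<in> cyl ((run M ^^ n) (prefix_of \<omega> l))" using Suc.IH[OF \<zeta>] by blast
    then have "prefix_of \<zeta> (length ((run M ^^ n) (prefix_of \<omega> l))) = (run M ^^ n) (prefix_of \<omega> l)"
      by (simp only: prefix_of_eq_iff)
    with run_prefix_of[of M \<zeta> "length ((run M ^^ n) (prefix_of \<omega> l))"] show ?thesis by simp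
  qed
  obtain t where t: "m \<le> length (output_at M \<zeta> t)"
    using \<open>outputs M \<zeta> \<eta>\<close> by (auto simp: outputs_def)
  obtain l' where "t \<le> length ((run M ^^ n) (prefix_of \<omega> l'))"
    using Suc.IH[OF \<zeta>] by blast
  from t prefix_length_le[OF output_at_mono[OF this, of M \<zeta>]]
  have "m \<le> length ((run M ^^ Suc n) (prefix_of \<omega> l'))"
    unfolding run_eq by linarith
  moreover have "\<eta> \<in> cyl ((run M ^^ Suc n) (prefix_of \<omega> l))"
    unfolding run_eq using \<open>outputs M \<zeta> \<eta>\<close> by (simp add: outputs_def)
  ultimately show ?case by blast
qed

text \<open>A work tape is simulated by two stacks, \<open>l\<close> read from the cell left of the head
  leftwards and \<open>r\<close> from the head rightwards.  Since \<open>prod_encode (0, 0) = 0\<close>, every number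
  codes an infinite stack, and \<open>0\<close> codes the blank one.\<close>

fun cell :: "nat \<Rightarrow> nat \<Rightarrow> nat" where
  "cell s 0 = p1 s"
| "cell s (Suc j) = cell (p2 s) j"

lemma prod_decode_0 [simp]: "prod_decode 0 = (0, 0)"
proof -
  have "prod_encode (0, 0) = 0" by (simp add: prod_encode_def)
  then show ?thesis using prod_encode_inverse[of "(0, 0)"] by simp
qed

lemma cell_0 [simp]: "cell 0 j = 0"
  by (induction j) simp_all

definition conf_code :: "nat \<Rightarrow> nat \<Rightarrow> nat \<Rightarrow> nat \<Rightarrow> bool list \<Rightarrow> nat" where
  "conf_code q i l r x =
     prod_encode (q, prod_encode (i, prod_encode (l, prod_encode (r, str_code x))))"

fun move_stacks :: "move \<Rightarrow> nat \<Rightarrow> nat \<Rightarrow> nat \<times> nat" where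
  "move_stacks MoveLeft l r = (p2 l, prod_encode (p1 l, r))"
| "move_stacks Stay l r = (l, r)"
| "move_stacks MoveRight l r = (prod_encode (p1 r, l), p2 r)"

definition code_step :: "machine \<Rightarrow> bool list \<Rightarrow> nat \<Rightarrow> nat" where
  "code_step M x u =
     (case map_of M (p1 u, ext x (p1 (p2 u)), p1 (p1 (p2 (p2 (p2 u))))) of
        None \<Rightarrow> u
      | Some (q, a, d, e, z) \<Rightarrow>
          conf_code q (move_in d (p1 (p2 u)))
            (fst (move_stacks e (p1 (p2 (p2 u))) (prod_encode (a, p2 (p1 (p2 (p2 (p2 u))))))))
            (snd (move_stacks e (p1 (p2 (p2 u))) (prod_encode (a, p2 (p1 (p2 (p2 (p2 u))))))))
            (str_decode (p2 (p2 (p2 (p2 u)))) @ (case z of None \<Rightarrow> [] | Some b \<Rightarrow> [b])))"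

definition codes_config :: "nat \<Rightarrow> config \<Rightarrow> bool" where
  "codes_config u c \<longleftrightarrow> (\<exists>l r. u = conf_code (state c) (inhead c) l r (out c) \<and>
     (\<forall>j. cell r j = work c (workhead c + int j)) \<and>
     (\<forall>j. cell l j = work c (workhead c - 1 - int j)))"

lemma codes_config_step:
  assumes "codes_config u c" shows "codes_config (code_step M x u) (step M (ext x) c)"
proof -
  obtain l r where u: "u = conf_code (state c) (inhead c) l r (out c)"
    and r: "\<And>j. cell r j = work c (workhead c + int j)"
    and l: "\<And>j. cell l j = work c (workhead c - 1 - int j)"
    using assms by (auto simp: codes_config_def)
  have r0: "p1 r = work c (workhead c)" using r[of 0] by simp
  show ?thesis
  proof (cases "map_of M (state c, ext x (inhead c), work c (workhead c))")
    case None
    with assms r0 show ?thesis by (simp add: u code_step_def step_def conf_code_def)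
  next
    case (Some v)
    obtain q a d e z where v: "v = (q, a, d, e, z)" by (cases v)
    define r' where "r' = prod_encode (a, p2 r)"
    define w where "w = (work c)(workhead c := a)"
    have r': "cell r' j = w (workhead c + int j)" for j
      using r[of j] by (cases j) (auto simp: r'_def w_def)
    have l': "cell l j = w (workhead c - 1 - int j)" for j
      using l[of j] by (auto simp: w_def)
    have "cell (snd (move_stacks e l r')) j = w (move_work e (workhead c) + int j) \<and>
          cell (fst (move_stacks e l r')) j = w (move_work e (workhead c) - 1 - int j)" for j
      using r'[of "Suc j"] r'[of "j - 1"] l'[of "Suc j"] l'[of "j - 1"] r'[of 0] l'[of 0] r'[of j] l'[of j]
      by (cases e; cases j) (simp_all add: algebra_simps)
    then show ?thesis
      using Some r0 unfolding codes_config_def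
      by (intro exI[of _ "fst (move_stacks e l r')"] exI[of _ "snd (move_stacks e l r')"])
        (simp add: v u code_step_def step_def conf_code_def r'_def w_def)
  qed
qed

lemma str_code_run:
  "str_code (run M x) = p2 (p2 (p2 (p2 (rec_nat 0 (\<lambda>_. code_step M x) (length x)))))"
proof -
  \<comment> \<open>Initial state, head position, blank stacks and empty output are all coded by 0,
    and pairing zeros gives 0 again.\<close>
  have "codes_config 0 init_config"
    unfolding codes_config_def
    by (intro exI[of _ 0]) (simp add: init_config_def conf_code_def str_code_def prod_encode_def)
  then have "codes_config (rec_nat 0 (\<lambda>_. code_step M x) t) ((step M (ext x) ^^ t) init_config)" for t
    by (induction t) (simp_all add: codes_config_step)
  from this[of "length x"] show ?thesis
    by (auto simp: codes_config_def conf_code_def run_def output_at_def)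
qed

text \<open>The transition table is a fixed finite list, so induction on it turns the lookup into a
  chain of conditionals; \<open>F v\<close> has to be recursive only for each entry
  separately.\<close>

lemma recursive_map_of:
  assumes "recursive q" "decidable b" "recursive a"
    and "\<And>v. recursive (F v)" "recursive G"
  shows "recursive (\<lambda>n. case map_of M (q n, b n, a n) of None \<Rightarrow> G n | Some v \<Rightarrow> F v n)"
proof (induction M)
  case (Cons kv M)
  obtain k1 k2 k3 v where kv: "kv = ((k1, k2, k3), v)" by (metis surj_pair)
  have "(case map_of (kv # M) (q n, b n, a n) of None \<Rightarrow> G n | Some v \<Rightarrow> F v n) =
      (if q n = k1 \<and> (b n \<longleftrightarrow> k2) \<and> a n = k3 then F v n
       else case map_of M (q n, b n, a n) of None \<Rightarrow> G n | Some v \<Rightarrow> F v n)" for n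
    by (auto simp: kv)
  with Cons show ?case using assms by (simp only:) (rule recursive_if; simp add: recursive_intros)
qed (use assms in simp)

lemma recursive_code_step:
  assumes x: "string_recursive x" and u: "recursive u"
  shows "recursive (\<lambda>n. code_step M (x n) (u n))"
  unfolding code_step_def
proof (rule recursive_map_of)
  fix v :: "nat \<times> nat \<times> move \<times> move \<times> bool option"
  obtain q a d e z where v: "v = (q, a, d, e, z)" by (cases v)
  show "recursive (\<lambda>n. case v of (q, a, d, e, z) \<Rightarrow>
          conf_code q (move_in d (p1 (p2 (u n))))
            (fst (move_stacks e (p1 (p2 (p2 (u n)))) (prod_encode (a, p2 (p1 (p2 (p2 (p2 (u n)))))))))
            (snd (move_stacks e (p1 (p2 (p2 (u n)))) (prod_encode (a, p2 (p1 (p2 (p2 (p2 (u n)))))))))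
            (str_decode (p2 (p2 (p2 (p2 (u n))))) @ (case z of None \<Rightarrow> [] | Some b \<Rightarrow> [b])))"
    unfolding v prod.case conf_code_def
    by (cases d; cases e; cases z; simp; intro recursive_intros u)
qed (intro recursive_intros x u)+

lemma string_recursive_run: "string_recursive (\<lambda>n. run M (str_decode n))"
  unfolding string_recursive_def str_code_run
  by (intro recursive_intros recursive_rec_nat recursive_code_step)

lemma string_recursive_funpow_run [recursive_intros]:
  "string_recursive f \<Longrightarrow> recursive g \<Longrightarrow> string_recursive (\<lambda>n. (run M ^^ g n) (f n))"
  by (rule string_recursive_funpow[OF string_recursive_run])

section \<open>The ergodic theorem\<close>

locale measure_preserving_map = prob_space +
  fixes \<tau> :: "'a \<Rightarrow> 'a"
  assumes measurable_map [measurable]: "\<tau> \<in> measurable M M"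
    and distr_map: "distr M M \<tau> = M"
begin

lemma integral_comp_map:
  fixes f :: "'a \<Rightarrow> real"
  assumes [measurable]: "f \<in> borel_measurable M"
  shows "(\<integral>\<omega>. f (\<tau> \<omega>) \<partial>M) = (\<integral>\<omega>. f \<omega> \<partial>M)"
  using integral_distr[of \<tau> M M f] by (simp add: distr_map)

lemma measurable_funpow_map [measurable]: "\<tau> ^^ n \<in> measurable M M"
  by (induction n) (simp_all add: measurable_comp[OF _ measurable_map])

lemma distr_funpow: "distr M M (\<tau> ^^ n) = M"
proof (induction n)
  case 0
  show ?case by (simp add: distr_id[unfolded id_def])
next
  case (Suc n)
  have "distr M M (\<tau> \<circ> (\<tau> ^^ n)) = distr (distr M M (\<tau> ^^ n)) M \<tau>"
    by (rule distr_distr[symmetric]) auto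
  with Suc show ?case by (simp add: distr_map comp_def)
qed

lemma measure_vimage_funpow:
  assumes "B \<in> sets M" shows "prob ((\<tau> ^^ n) -` B \<inter> space M) = prob B"
  using measure_distr[OF measurable_funpow_map assms, of n] by (simp add: distr_funpow)

definition birkhoff :: "('a \<Rightarrow> real) \<Rightarrow> nat \<Rightarrow> 'a \<Rightarrow> real" where
  "birkhoff g n \<omega> = (\<Sum>i<n. g ((\<tau> ^^ i) \<omega>))"

lemma birkhoff_Suc: "birkhoff g (Suc n) \<omega> = g \<omega> + birkhoff g n (\<tau> \<omega>)"
  unfolding birkhoff_def by (subst sum.lessThan_Suc_shift) (simp add: funpow_swap1)

lemma measurable_birkhoff [measurable]:
  assumes [measurable]: "g \<in> borel_measurable M"
  shows "birkhoff g n \<in> borel_measurable M"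
  unfolding birkhoff_def by measurable

text \<open>The recursion computes the maximum of \<open>birkhoff g k\<close> over \<open>k \<le> n\<close>.\<close>

primrec max_birkhoff :: "('a \<Rightarrow> real) \<Rightarrow> nat \<Rightarrow> 'a \<Rightarrow> real" where
  "max_birkhoff g 0 = (\<lambda>\<omega>. 0)"
| "max_birkhoff g (Suc n) = (\<lambda>\<omega>. max 0 (g \<omega> + max_birkhoff g n (\<tau> \<omega>)))"

lemma birkhoff_le_max: "k \<le> n \<Longrightarrow> birkhoff g k \<omega> \<le> max_birkhoff g n \<omega>"
proof (induction n arbitrary: k \<omega>)
  case (Suc n)
  show ?case
  proof (cases k)
    case (Suc j)
    with Suc.IH[of j "\<tau> \<omega>"] Suc.prems show ?thesis by (simp add: birkhoff_Suc max.coboundedI2)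
  qed (simp add: birkhoff_def)
qed (simp add: birkhoff_def)

lemma max_birkhoff_nonneg: "0 \<le> max_birkhoff g n \<omega>"
  by (cases n) simp_all

lemma max_birkhoff_mono: "max_birkhoff g n \<omega> \<le> max_birkhoff g (Suc n) \<omega>"
proof (induction n arbitrary: \<omega>)
  case (Suc n)
  from Suc[of "\<tau> \<omega>"] show ?case by (simp add: max_def)
qed simp

lemma measurable_max_birkhoff [measurable]:
  assumes [measurable]: "g \<in> borel_measurable M"
  shows "max_birkhoff g n \<in> borel_measurable M"
  by (induction n) auto

lemma max_birkhoff_bounded:
  assumes "\<And>\<omega>. \<bar>g \<omega>\<bar> \<le> c"
  shows "max_birkhoff g n \<omega> \<le> real n * c"
proof (induction n arbitrary: \<omega>)
  case (Suc n)
  have "0 \<le> c" using assms[of undefined] by linarith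
  moreover have "g \<omega> \<le> c" using assms[of \<omega>] by linarith
  ultimately show ?case using Suc[of "\<tau> \<omega>"] by (auto simp: algebra_simps)
qed simp

text \<open>Garsia's argument: where the maximum is positive, \<open>g\<close> dominates the difference of the
  maximum and its composition with \<open>\<tau>\<close>, whose integral vanishes.\<close>

lemma maximal_ergodic:
  assumes g [measurable]: "g \<in> borel_measurable M" and bound: "\<And>\<omega>. \<bar>g \<omega>\<bar> \<le> c"
    and pos: "AE \<omega> in M. \<exists>n. 0 < birkhoff g n \<omega>"
  shows "0 \<le> (\<integral>\<omega>. g \<omega> \<partial>M)"
proof -
  define h where "h n \<omega> = (if 0 < max_birkhoff g n \<omega> then g \<omega> else 0)" for n \<omega>
  have h [measurable]: "h n \<in> borel_measurable M" for n
    unfolding h_def by measurable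
  have "0 \<le> c" using bound[of undefined] by linarith
  have bound_max: "\<bar>max_birkhoff g n \<omega>\<bar> \<le> real n * c" for n \<omega>
    using max_birkhoff_bounded[OF bound] max_birkhoff_nonneg by (simp add: abs_of_nonneg)
  have int_max: "integrable M (max_birkhoff g n)" for n
    by (rule integrable_const_bound[where B = "real n * c"]) (auto simp: bound_max)
  have int_max': "integrable M (\<lambda>\<omega>. max_birkhoff g n (\<tau> \<omega>))" for n
    by (rule integrable_const_bound[where B = "real n * c"]) (auto simp: bound_max)
  have int_h: "integrable M (h n)" for n
    by (rule integrable_const_bound[where B = c]) (use bound \<open>0 \<le> c\<close> in \<open>auto simp: h_def\<close>)
  have "0 \<le> (\<integral>\<omega>. h (Suc n) \<omega> \<partial>M)" for n
  proof -
    \<comment> \<open>If the new maximum is positive, it equals \<open>g\<close> plus the old one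
      after \<open>\<tau>\<close>, and it dominates the old one. If it is 0, so is the old
      one.\<close>
    have "max_birkhoff g n \<omega> - max_birkhoff g n (\<tau> \<omega>) \<le> h (Suc n) \<omega>" for \<omega>
      using max_birkhoff_mono[of g n \<omega>] max_birkhoff_nonneg[of g n "\<tau> \<omega>"]
      by (auto simp: h_def max_def split: if_splits)
    then have "(\<integral>\<omega>. max_birkhoff g n \<omega> - max_birkhoff g n (\<tau> \<omega>) \<partial>M) \<le> (\<integral>\<omega>. h (Suc n) \<omega> \<partial>M)"
      by (intro integral_mono Bochner_Integration.integrable_diff int_max int_max' int_h)
    then show ?thesis by (simp add: int_max int_max' integral_comp_map)
  qed
  moreover have "(\<lambda>n. \<integral>\<omega>. h (Suc n) \<omega> \<partial>M) \<longlonglongrightarrow> (\<integral>\<omega>. g \<omega> \<partial>M)"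
  proof (rule integral_dominated_convergence[where w = "\<lambda>_. c"])
    show "AE \<omega> in M. (\<lambda>n. h (Suc n) \<omega>) \<longlonglongrightarrow> g \<omega>"
      using pos
    proof eventually_elim
      fix \<omega> assume "\<exists>n. 0 < birkhoff g n \<omega>"
      then obtain n where n: "0 < birkhoff g n \<omega>" by blast
      have "h (Suc k) \<omega> = g \<omega>" if "n \<le> k" for k
        using birkhoff_le_max[of n "Suc k" g \<omega>] n that unfolding h_def by auto
      then show "(\<lambda>n. h (Suc n) \<omega>) \<longlonglongrightarrow> g \<omega>"
        by (intro tendsto_eventually eventually_sequentiallyI)
    qed
  qed (use bound \<open>0 \<le> c\<close> in \<open>auto simp: h_def\<close>)
  ultimately show ?thesis by (intro LIMSEQ_le_const) auto
qed

end

text \<open>Exact invariance fits the later use: the set of points whose Birkhoff sums are unbounded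
  above is exactly invariant.\<close>

locale ergodic_map = measure_preserving_map +
  assumes ergodic_map: "B \<in> sets M \<Longrightarrow> \<tau> -` B \<inter> space M = B \<Longrightarrow> prob B = 0 \<or> prob B = 1"
begin

text \<open>Sums along \<open>\<omega>\<close> and \<open>\<tau> \<omega>\<close> differ by the
  shift \<open>g \<omega>\<close>, so the set with sums unbounded above is invariant. If it had
  measure 1, some sum would be positive almost everywhere, and \<open>maximal_ergodic\<close> would
  contradict the negative integral.\<close>

lemma AE_birkhoff_bounded_above:
  assumes g [measurable]: "g \<in> borel_measurable M" and bound: "\<And>\<omega>. \<bar>g \<omega>\<bar> \<le> c"
    and neg: "(\<integral>\<omega>. g \<omega> \<partial>M) < 0"
  shows "AE \<omega> in M. \<exists>b. \<forall>n. birkhoff g n \<omega> \<le> b"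
proof -
  define B where "B = {\<omega>\<in>space M. \<forall>k::nat. \<exists>n. real k < birkhoff g n \<omega>}"
  have [measurable]: "B \<in> sets M" unfolding B_def by measurable
  have B: "\<omega> \<in> B \<longleftrightarrow> \<omega> \<in> space M \<and> (\<forall>b. \<exists>n. b < birkhoff g n \<omega>)" for \<omega>
    unfolding B_def by (auto intro: order.strict_trans) (meson le_less_trans real_arch_simple)
  have "(\<forall>b. \<exists>n. b < birkhoff g n (\<tau> \<omega>)) \<longleftrightarrow> (\<forall>b. \<exists>n. b < birkhoff g n \<omega>)" for \<omega>
  proof safe
    fix b assume "\<forall>b. \<exists>n. b < birkhoff g n (\<tau> \<omega>)"
    then obtain n where "b - g \<omega> < birkhoff g n (\<tau> \<omega>)" by blast
    then have "b < birkhoff g (Suc n) \<omega>" by (simp add: birkhoff_Suc)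
    then show "\<exists>n. b < birkhoff g n \<omega>" ..
  next
    fix b assume "\<forall>b. \<exists>n. b < birkhoff g n \<omega>"
    \<comment> \<open>The 0 in the maximum rules out \<open>n = 0\<close>, whose sum is
      empty.\<close>
    then obtain n where n: "max 0 (b + g \<omega>) < birkhoff g n \<omega>" by blast
    then obtain m where "n = Suc m" by (cases n) (auto simp: birkhoff_def)
    with n have "b < birkhoff g m (\<tau> \<omega>)" by (simp add: birkhoff_Suc)
    then show "\<exists>n. b < birkhoff g n (\<tau> \<omega>)" ..
  qed
  then have "\<tau> -` B \<inter> space M = B"
    using measurable_space[OF measurable_map] by (auto simp: B)
  then have "prob B = 0 \<or> prob B = 1" by (rule ergodic_map[rotated]) simp
  moreover have "prob B \<noteq> 1"
  proof
    assume "prob B = 1"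
    then have "AE \<omega> in M. \<omega> \<in> B" by (simp add: prob_eq_1)
    then have "AE \<omega> in M. \<exists>n. 0 < birkhoff g n \<omega>" by eventually_elim (simp add: B)
    from maximal_ergodic[OF g bound this] neg show False by simp
  qed
  ultimately have "AE \<omega> in M. \<omega> \<notin> B" by (simp add: prob_eq_0)
  with AE_space show ?thesis by eventually_elim (auto simp: B not_less)
qed

text \<open>Centring with half of \<open>\<eta>\<close> gives integral \<open>- \<eta> / 2\<close>,
  hence sums bounded above almost everywhere. A visit frequency of \<open>prob J + \<eta>\<close>
  would push the sum to at least \<open>N * \<eta> / 2\<close>, so almost every point leaves the
  exceptional sets for good.\<close>

lemma ergodic_in_probability:
  assumes J [measurable]: "J \<in> sets M" and \<eta>: "0 < \<eta>" and \<delta>: "0 < \<delta>"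
  shows "\<exists>N\<ge>1. prob {\<omega>\<in>space M. (prob J + \<eta>) * real N
           \<le> birkhoff (indicator J) N \<omega>} < \<delta>"
proof -
  define g where "g \<omega> = indicator J \<omega> - (prob J + \<eta> / 2)" for \<omega>
  have g [measurable]: "g \<in> borel_measurable M" unfolding g_def by measurable
  have birkhoff_g: "birkhoff g n \<omega> = birkhoff (indicator J) n \<omega> - real n * (prob J + \<eta> / 2)" for n \<omega>
    by (simp add: birkhoff_def g_def sum_subtractf)
  have "AE \<omega> in M. \<exists>b. \<forall>n. birkhoff g n \<omega> \<le> b"
  proof (rule AE_birkhoff_bounded_above[where c = "2 + \<eta>"])
    show "\<bar>g \<omega>\<bar> \<le> 2 + \<eta>" for \<omega>
    proof -
      have "0 \<le> prob J" "prob J \<le> 1" by simp_all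
      moreover have "indicat_real J \<omega> = 0 \<or> indicat_real J \<omega> = 1" by (simp add: indicator_def)
      ultimately show ?thesis using \<eta> unfolding g_def by linarith
    qed
    have "(\<integral>\<omega>. g \<omega> \<partial>M) = (\<integral>\<omega>. indicator J \<omega> \<partial>M) - (\<integral>\<omega>. prob J + \<eta> / 2 \<partial>M)"
      unfolding g_def by (rule Bochner_Integration.integral_diff) (auto simp: less_top[symmetric])
    then have "(\<integral>\<omega>. g \<omega> \<partial>M) = - (\<eta> / 2)" by (simp add: prob_space)
    with \<eta> show "(\<integral>\<omega>. g \<omega> \<partial>M) < 0" by simp
  qed simp
  define E where "E n = {\<omega>\<in>space M. (prob J + \<eta>) * real n \<le> birkhoff (indicator J) n \<omega>}" for n
  have [measurable]: "E n \<in> sets M" for n unfolding E_def by measurable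
  have "(\<lambda>n. \<integral>\<omega>. indicat_real (E n) \<omega> \<partial>M) \<longlonglongrightarrow> (\<integral>\<omega>. 0 \<partial>M)"
  proof (rule integral_dominated_convergence[where w = "\<lambda>_. 1"])
    show "AE \<omega> in M. (\<lambda>n. indicat_real (E n) \<omega>) \<longlonglongrightarrow> 0"
      using \<open>AE \<omega> in M. \<exists>b. \<forall>n. birkhoff g n \<omega> \<le> b\<close>
    proof eventually_elim
      fix \<omega> assume "\<exists>b. \<forall>n. birkhoff g n \<omega> \<le> b"
      then obtain b where b: "birkhoff g n \<omega> \<le> b" for n by blast
      obtain k where k: "2 * b / \<eta> < real k" using reals_Archimedean2 by blast
      have "indicat_real (E n) \<omega> = 0" if "k \<le> n" for n
      proof -
        have "2 * b / \<eta> < real n" using k that by linarith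
        then have "b < \<eta> / 2 * real n" using \<eta> by (simp add: field_simps)
        with b[of n] have "birkhoff (indicator J) n \<omega> < (prob J + \<eta>) * real n"
          by (simp add: birkhoff_g algebra_simps)
        then show ?thesis by (simp add: E_def)
      qed
      then show "(\<lambda>n. indicat_real (E n) \<omega>) \<longlonglongrightarrow> 0"
        by (intro tendsto_eventually eventually_sequentiallyI)
    qed
  qed (auto simp: indicator_def)
  then have "(\<lambda>n. prob (E n)) \<longlonglongrightarrow> 0" by simp
  from order_tendstoD(2)[OF this \<delta>] obtain k where "\<And>n. k \<le> n \<Longrightarrow> prob (E n) < \<delta>"
    by (auto simp: eventually_sequentially)
  then have "prob (E (max 1 k)) < \<delta>" by simp
  then show ?thesis unfolding E_def by (intro exI[of _ "max 1 k"]) simp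
qed

end

context measure_preserving_map
begin

text \<open>Pulling back by \<open>\<tau> ^^ (N - 1 - n)\<close> moves all dependence on \<open>n\<close> into the visits to \<open>J\<close>, so
  that one bound on the frequency of visits to \<open>J\<close> serves all \<open>B\<close> at once.\<close>

lemma sum_measure_inter_vimage_le:
  assumes J [measurable]: "J \<in> sets M" and B [measurable]: "B \<in> sets M" and "0 \<le> q"
    and C [measurable]: "C \<in> sets M"
    and C: "{\<omega>\<in>space M. q * real N < birkhoff (indicator J) N \<omega>} \<subseteq> C"
  shows "(\<Sum>n<N. prob (J \<inter> (\<tau> ^^ n) -` B)) \<le> real N * (q * prob B + prob C)"
proof -
  let ?B = "(\<tau> ^^ (N - 1)) -` B \<inter> space M"
  have [measurable]: "?B \<in> sets M" by (rule measurable_sets[OF measurable_funpow_map B])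
  have JB [measurable]: "J \<inter> (\<tau> ^^ n) -` B \<in> sets M" for n
  proof -
    have "J \<inter> (\<tau> ^^ n) -` B = J \<inter> ((\<tau> ^^ n) -` B \<inter> space M)"
      using sets.sets_into_space[OF J] by blast
    then show ?thesis by (simp add: measurable_sets[OF measurable_funpow_map])
  qed
  have "prob (J \<inter> (\<tau> ^^ n) -` B) = (\<integral>\<omega>. indicator J ((\<tau> ^^ (N - Suc n)) \<omega>) * indicator ?B \<omega> \<partial>M)"
    if "n < N" for n
  proof -
    have "prob (J \<inter> (\<tau> ^^ n) -` B)
        = prob ((\<tau> ^^ (N - Suc n)) -` (J \<inter> (\<tau> ^^ n) -` B) \<inter> space M)"
      by (rule measure_vimage_funpow[OF JB, symmetric])
    also have "(\<tau> ^^ n) ((\<tau> ^^ (N - Suc n)) \<omega>) = (\<tau> ^^ (N - 1)) \<omega>" for \<omega>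
      using that by (simp add: funpow_add[symmetric, unfolded comp_def, THEN fun_cong])
    then have "(\<tau> ^^ (N - Suc n)) -` (J \<inter> (\<tau> ^^ n) -` B) \<inter> space M
        = ((\<tau> ^^ (N - Suc n)) -` J \<inter> space M) \<inter> ?B" by auto
    also have "prob \<dots> = (\<integral>\<omega>. indicator (((\<tau> ^^ (N - Suc n)) -` J \<inter> space M) \<inter> ?B) \<omega> \<partial>M)"
      by simp
    also have "\<dots> = (\<integral>\<omega>. indicator J ((\<tau> ^^ (N - Suc n)) \<omega>) * indicator ?B \<omega> \<partial>M)"
      by (intro Bochner_Integration.integral_cong) (auto simp: indicator_def)
    finally show ?thesis .
  qed
  then have "(\<Sum>n<N. prob (J \<inter> (\<tau> ^^ n) -` B))
      = (\<Sum>n<N. \<integral>\<omega>. indicator J ((\<tau> ^^ (N - Suc n)) \<omega>) * indicator ?B \<omega> \<partial>M)"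
    by simp
  also have "\<dots> = (\<Sum>n<N. \<integral>\<omega>. indicator J ((\<tau> ^^ n) \<omega>) * indicator ?B \<omega> \<partial>M)"
    by (rule sum.nat_diff_reindex)
  also have "\<dots> = (\<integral>\<omega>. birkhoff (indicator J) N \<omega> * indicator ?B \<omega> \<partial>M)"
    unfolding birkhoff_def sum_distrib_right
    by (intro Bochner_Integration.integral_sum[symmetric] integrable_const_bound[where B = 1])
      (auto simp: indicator_def)
  \<comment> \<open>Off \<open>C\<close> there are at most \<open>q * N\<close> visits; on
    \<open>C\<close> the trivial bound \<open>N\<close> is used.\<close>
  also have "\<dots> \<le> (\<integral>\<omega>. q * real N * indicator ?B \<omega> + real N * indicator C \<omega> \<partial>M)"
  proof (rule integral_mono_AE)
    have le: "birkhoff (indicator J) N \<omega> \<le> real N" for \<omega>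
      using sum_bounded_above[of "{..<N}" "\<lambda>i. indicat_real J ((\<tau> ^^ i) \<omega>)" 1]
      by (simp add: birkhoff_def indicator_def)
    have nonneg: "0 \<le> birkhoff (indicator J) N \<omega>" for \<omega>
      by (simp add: birkhoff_def sum_nonneg)
    show "integrable M (\<lambda>\<omega>. birkhoff (indicator J) N \<omega> * indicator ?B \<omega>)"
      by (rule integrable_const_bound[where B = "real N"])
        (use le nonneg in \<open>auto simp: indicator_def\<close>)
    show "AE \<omega> in M. birkhoff (indicator J) N \<omega> * indicator ?B \<omega>
        \<le> q * real N * indicator ?B \<omega> + real N * indicator C \<omega>"
      using AE_space
    proof eventually_elim
      fix \<omega> assume "\<omega> \<in> space M"
      then have "\<omega> \<in> C \<or> birkhoff (indicator J) N \<omega> \<le> q * real N" using C by force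
      then show "birkhoff (indicator J) N \<omega> * indicator ?B \<omega>
        \<le> q * real N * indicator ?B \<omega> + real N * indicator C \<omega>"
        using le[of \<omega>] nonneg[of \<omega>] mult_nonneg_nonneg[OF \<open>0 \<le> q\<close>, of "real N"]
        by (auto simp: indicator_def)
    qed
  qed (auto intro!: Bochner_Integration.integrable_add integrable_mult_right simp: less_top[symmetric])
  also have "\<dots> = q * real N * prob ?B + real N * prob C"
    by (subst Bochner_Integration.integral_add) (auto simp: less_top[symmetric])
  also have "prob ?B = prob B" by (rule measure_vimage_funpow) simp
  finally show ?thesis by (simp add: algebra_simps)
qed

end

section \<open>Strings and cylinders\<close>

lemma str_code_eq: "str_code x = prod_encode (length x, p2 (str_code x))"
  by (metis p1_str_code prod.collapse prod_decode_inverse)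

lemma p2_str_code_less: "p2 (str_code x) < 2 ^ length x"
proof -
  have "str_code x = prod_encode (length x, p2 (str_code x) mod 2 ^ length x)"
    using str_code_str_decode[of "str_code x"] by simp
  then have "p2 (str_code x) = p2 (str_code x) mod 2 ^ length x"
    by (metis prod_encode_inverse snd_conv)
  then show ?thesis by (metis mod_less_divisor zero_less_numeral zero_less_power)
qed

text \<open>Brings the sum in \<open>test\<close> into the form to which
  \<open>recursive_sum\<close> applies.\<close>

lemma sum_strings:
  "(\<Sum>x | length x = l. F x) = (\<Sum>v<2 ^ l. F (str_decode (prod_encode (l, v))))"
proof (rule sum.reindex_bij_witness[where i = "\<lambda>v. str_decode (prod_encode (l, v))"
      and j = "\<lambda>x. p2 (str_code x)"])
  fix x :: "bool list" assume "x \<in> {x. length x = l}"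
  then show "str_decode (prod_encode (l, p2 (str_code x))) = x"
    by (metis mem_Collect_eq str_code_eq str_decode_str_code)
  then show "F (str_decode (prod_encode (l, p2 (str_code x)))) = F x" by simp
  show "p2 (str_code x) \<in> {..<2 ^ l}"
    using p2_str_code_less[of x] \<open>x \<in> _\<close> by simp
next
  fix v :: nat assume "v \<in> {..<2 ^ l}"
  then show "p2 (str_code (str_decode (prod_encode (l, v)))) = v"
    by (simp add: str_code_str_decode)
  show "str_decode (prod_encode (l, v)) \<in> {x. length x = l}"
    by (simp add: str_decode_def)
qed

lemma finite_strings [simp]: "finite {x :: bool list. length x = l}"
  using finite_lists_length_eq[of "UNIV :: bool set" l] by simp

lemma card_strings: "card {x :: bool list. length x = l} = 2 ^ l"
  using card_lists_length_eq[of "UNIV :: bool set" l] by simp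

lemma finite_strings_le [simp]: "finite {x :: bool list. length x \<le> l}"
  using finite_lists_length_le[of "UNIV :: bool set" l] by simp

lemma prefix_of_two_cyls: "\<omega> \<in> cyl x \<Longrightarrow> \<omega> \<in> cyl y \<Longrightarrow> length x \<le> length y \<Longrightarrow> prefix x y"
  by (metis prefix_of_eq_iff prefix_prefix_of)

text \<open>Codes are distinct, so this is part of the geometric series. It allows errors
  proportional to \<open>(1 / 2) ^ str_code y\<close> to be added over a whole level.\<close>

lemma sum_half_power_str_code_le:
  "finite Y \<Longrightarrow> (\<Sum>y\<in>Y. (1 / 2) ^ str_code y) \<le> (2 :: real)"
proof -
  assume "finite Y"
  have "(\<Sum>y\<in>Y. (1 / 2) ^ str_code y) = (\<Sum>n\<in>str_code ` Y. (1 / 2 :: real) ^ n)"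
    by (subst sum.reindex) (auto intro: inj_on_subset[OF inj_str_code])
  also have "\<dots> \<le> (\<Sum>n. (1 / 2) ^ n)"
    using \<open>finite Y\<close> by (intro sum_le_suminf summable_geometric) simp_all
  also have "\<dots> = 2" by (subst suminf_geometric) simp_all
  finally show ?thesis .
qed

lemma open_cyl: "open (cyl x)"
proof -
  have "open ((\<lambda>\<omega> :: cantor. \<omega> i) -` {b})" for i b
  proof (rule open_vimage)
    show "open {b}" by (rule Topological_Spaces.open_discrete)
  qed (rule continuous_on_product_coordinates)
  then have "open (\<Inter>i<length x. (\<lambda>\<omega> :: cantor. \<omega> i) -` {x ! i})"
    by (intro open_INT) auto
  also have "(\<Inter>i<length x. (\<lambda>\<omega>. \<omega> i) -` {x ! i}) = cyl x"
    by (auto simp: cyl_def)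
  finally show ?thesis .
qed

section \<open>The cover\<close>

text \<open>Later \<open>weight x m\<close> approximates \<open>2 ^ m * \<mu> (cyl x)\<close> up to \<open>2\<close>.  A passed
  \<open>test e y (prod_encode (N, l))\<close> certifies that the frequency of visits to \<open>cyl y\<close> before time \<open>N\<close>
  exceeds \<open>\<mu> (cyl y) + 5 / 2 ^ e\<close> only on a set of measure at most \<open>5 / 2 ^ e\<close>; the iterates are
  computed from inputs of length \<open>l\<close>, and an iterate counts as a visit unless it is seen to leave
  \<open>cyl y\<close>.\<close>

locale cover_construction =
  fixes mach :: machine and enum :: "nat \<Rightarrow> bool list option"
    and weight :: "bool list \<Rightarrow> nat \<Rightarrow> nat"
begin

text \<open>Bounding the stage \<open>t\<close> by the length makes this decidable and still
  monotone in \<open>x\<close>, and every point of the enumerated open set has prefixes that satisfy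
  it.\<close>

definition in_open :: "bool list \<Rightarrow> bool" where
  "in_open x \<longleftrightarrow> (\<exists>t<length x. \<exists>p\<le>length x. enum t = Some (take p x))"

text \<open>The two truncations agree exactly if one of the strings is a prefix of the
  other.\<close>

definition visits :: "nat \<Rightarrow> bool list \<Rightarrow> bool list \<Rightarrow> nat" where
  "visits N y x = (\<Sum>n<N. of_bool (take (length ((run mach ^^ n) x)) y = take (length y) ((run mach ^^ n) x)))"

text \<open>Compares the frequency with \<open>(weight y e + 3) / 2 ^ e\<close>, cleared of
  denominators. As \<open>weight\<close> is accurate up to 2, this threshold lies between
  \<open>prob (cyl y) + 1 / 2 ^ e\<close> and \<open>prob (cyl y) + 5 / 2 ^ e\<close>.\<close>

definition heavy :: "nat \<Rightarrow> nat \<Rightarrow> bool list \<Rightarrow> bool list \<Rightarrow> bool" where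
  "heavy e N y x \<longleftrightarrow> (weight y e + 3) * N < 2 ^ e * visits N y x"

text \<open>Let \<open>l = p2 s\<close>. At scale \<open>2 ^ (l + e)\<close> a measure of
  \<open>1 / 2 ^ e\<close> becomes \<open>2 ^ l\<close>, and rounding adds at most 2 for each of at
  most \<open>2 ^ l\<close> strings, whence the bound \<open>3 * 2 ^ l\<close>. Conversely the bound
  leaves at most \<open>5 * 2 ^ l\<close>, that is, measure \<open>5 / 2 ^ e\<close>.\<close>

definition test :: "nat \<Rightarrow> bool list \<Rightarrow> nat \<Rightarrow> bool" where
  "test e y s \<longleftrightarrow> 1 \<le> p1 s \<and>
     (\<Sum>x | length x = p2 s. if heavy e (p1 s) y x then weight x (p2 s + e) else 0) \<le> 3 * 2 ^ p2 s"

text \<open>Taking the first \<open>s\<close> that passes makes the number of iterates required in the open set a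
  function of \<open>y\<close> alone.\<close>

definition good :: "nat \<Rightarrow> bool list \<Rightarrow> bool list \<Rightarrow> bool" where
  "good e y x \<longleftrightarrow> (\<exists>s\<le>length x. test e y s \<and> (\<forall>s'<s. \<not> test e y s') \<and>
     (\<forall>n<p1 s. in_open ((run mach ^^ n) x)))"

text \<open>The value \<open>length x + 1\<close> of \<open>next_pos E x i\<close> signals that no prefix of \<open>x\<close> qualifies; it is
  passed on by further applications.\<close>

definition next_pos :: "nat \<Rightarrow> bool list \<Rightarrow> nat \<Rightarrow> nat" where
  "next_pos E x i = (LEAST p. length x < p \<or>
     i \<le> p \<and> good (str_code (take i x) + E) (take i x) (take p x))"

definition pos :: "nat \<Rightarrow> nat \<Rightarrow> bool list \<Rightarrow> nat" where
  "pos E k x = rec_nat 0 (\<lambda>_. next_pos E x) k"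

text \<open>\<open>pos\<close> acts as a stopping time along \<open>x\<close>; the strings at whose
  end the \<open>k\<close>-th stage stops form a prefix-free set.\<close>

definition level :: "nat \<Rightarrow> nat \<Rightarrow> bool list set" where
  "level E k = {x. pos E k x = length x}"

lemma pos_simps [simp]: "pos E 0 x = 0" "pos E (Suc k) x = next_pos E x (pos E k x)"
  by (simp_all add: pos_def)

section \<open>Stopping-time structure of the levels\<close>

lemma in_open_mono: "prefix x x' \<Longrightarrow> in_open x \<Longrightarrow> in_open x'"
proof -
  assume xx': "prefix x x'" and "in_open x"
  then obtain t p where "t < length x" "p \<le> length x" "enum t = Some (take p x)"
    by (auto simp: in_open_def)
  moreover have "take p x = take p x'" "length x \<le> length x'"
    using xx' \<open>p \<le> length x\<close> by (auto simp: prefix_def)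
  ultimately show ?thesis unfolding in_open_def by (metis order.strict_trans2 order.trans)
qed

lemma next_pos_cases:
  obtains (fail) "length x < next_pos E x i"
    | (success) "next_pos E x i \<le> length x" "i \<le> next_pos E x i"
      "good (str_code (take i x) + E) (take i x) (take (next_pos E x i) x)"
  using LeastI[of "\<lambda>p. length x < p \<or> i \<le> p \<and> good (str_code (take i x) + E) (take i x) (take p x)"
      "Suc (length x)"]
  unfolding next_pos_def[symmetric] by (metis lessI not_less)

text \<open>Success at a position depends only on the bits before it, and so does the failure of
  every smaller position.\<close>

lemma next_pos_prefix:
  assumes "next_pos E x i \<le> length x" and "i \<le> length x"
    and "prefix (take (next_pos E x i) x) x'"
  shows "next_pos E x' i = next_pos E x i"
proof -
  let ?p = "next_pos E x i"
  from assms(1) have ip: "i \<le> ?p" and good: "good (str_code (take i x) + E) (take i x) (take ?p x)"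
    by (cases rule: next_pos_cases[of x E i]; simp)+
  have take: "take q x' = take q x" if "q \<le> ?p" for q
    using assms(1,3) that by (auto simp: prefix_def min_def)
  have len: "?p \<le> length x'"
    using prefix_length_le[OF assms(3)] assms(1) by simp
  show ?thesis
    unfolding next_pos_def[of E x' i]
  proof (rule Least_equality)
    show "length x' < ?p \<or> i \<le> ?p \<and> good (str_code (take i x') + E) (take i x') (take ?p x')"
      using ip good by (simp add: take)
  next
    fix q assume q: "length x' < q \<or> i \<le> q \<and> good (str_code (take i x') + E) (take i x') (take q x')"
    show "?p \<le> q"
    proof (rule ccontr)
      assume "\<not> ?p \<le> q"
      then have "i \<le> q \<and> good (str_code (take i x) + E) (take i x) (take q x)"
        using q len ip by (simp add: take)
      then have "?p \<le> q" unfolding next_pos_def by (intro Least_le) blast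
      with \<open>\<not> ?p \<le> q\<close> show False ..
    qed
  qed
qed

lemma pos_mono: "pos E (Suc k) x \<le> length x \<Longrightarrow> pos E k x \<le> pos E (Suc k) x"
  by (cases rule: next_pos_cases[of x E "pos E k x"]) simp_all

lemma pos_prefix:
  "pos E k x \<le> length x \<Longrightarrow> prefix (take (pos E k x) x) x' \<Longrightarrow> pos E k x' = pos E k x"
proof (induction k)
  case (Suc k)
  from pos_mono[OF Suc.prems(1)] have le: "pos E k x \<le> pos E (Suc k) x" .
  then have "prefix (take (pos E k x) x) (take (pos E (Suc k) x) x)"
    by (simp add: prefix_iff_take min_def)
  with Suc.prems(2) have "prefix (take (pos E k x) x) x'" by (rule prefix_order.trans[rotated])
  with Suc.IH le Suc.prems(1) have "pos E k x' = pos E k x" by simp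
  moreover have "next_pos E x' (pos E k x) = next_pos E x (pos E k x)"
    using Suc.prems le by (intro next_pos_prefix) (simp_all only: pos_simps)
  ultimately show ?case by simp
qed simp

lemma level_antichain: "x \<in> level E k \<Longrightarrow> x' \<in> level E k \<Longrightarrow> prefix x x' \<Longrightarrow> x = x'"
  using pos_prefix[of E k x x'] by (auto simp: level_def prefix_def)

lemma level_Suc_D:
  assumes "x \<in> level E (Suc k)"
  defines "y \<equiv> take (pos E k x) x"
  shows "y \<in> level E k" and "prefix y x" and "good (str_code y + E) y x"
proof -
  have x: "pos E (Suc k) x = length x" using assms by (simp add: level_def)
  then have le: "pos E k x \<le> length x" using pos_mono[of E k x] by simp
  show "prefix y x" by (simp add: y_def take_is_prefix)
  show "good (str_code y + E) y x"
    using x unfolding y_def by (cases rule: next_pos_cases[of x E "pos E k x"]) simp_all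
  have "pos E k y = pos E k x" by (rule pos_prefix[OF le]) (simp add: y_def)
  with le show "y \<in> level E k" by (simp add: level_def y_def)
qed

text \<open>The witness is the shortest good prefix of length at least \<open>i\<close>, at which
  \<open>next_pos\<close> stops; it may be shorter than \<open>j\<close>.\<close>

lemma level_Suc_I:
  assumes "prefix_of \<omega> i \<in> level E k" and "i \<le> j"
    and "good (str_code (prefix_of \<omega> i) + E) (prefix_of \<omega> i) (prefix_of \<omega> j)"
  shows "\<exists>l. prefix_of \<omega> l \<in> level E (Suc k)"
proof -
  let ?P = "\<lambda>p. i \<le> p \<and> good (str_code (prefix_of \<omega> i) + E) (prefix_of \<omega> i) (prefix_of \<omega> p)"
  define l where "l = (LEAST p. ?P p)"
  have l: "?P l" unfolding l_def by (rule LeastI[of ?P j]) (use assms in simp)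
  have "pos E k (prefix_of \<omega> l) = i"
    using pos_prefix[of E k "prefix_of \<omega> i" "prefix_of \<omega> l"] assms(1) l
    by (simp add: level_def prefix_prefix_of)
  moreover have "next_pos E (prefix_of \<omega> l) i = l"
    unfolding next_pos_def
  proof (rule Least_equality)
    fix p assume p: "length (prefix_of \<omega> l) < p \<or>
       i \<le> p \<and> good (str_code (take i (prefix_of \<omega> l)) + E) (take i (prefix_of \<omega> l)) (take p (prefix_of \<omega> l))"
    show "l \<le> p"
    proof (rule ccontr)
      assume "\<not> l \<le> p"
      then have "?P p" using p l by (simp add: min_def)
      then have "l \<le> p" unfolding l_def by (rule Least_le)
      with \<open>\<not> l \<le> p\<close> show False ..
    qed
  qed (use l in \<open>simp add: min_def\<close>)
  ultimately show ?thesis by (auto simp: level_def)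
qed

end

section \<open>Computability of the cover\<close>

lemma decidable_comp: "decidable P \<Longrightarrow> recursive g \<Longrightarrow> decidable (\<lambda>n. P (g n))"
  unfolding decidable_def by (rule recursive_comp)

locale computable_cover_construction = cover_construction +
  assumes recursive_enum: "recursive (\<lambda>n. encode (enum n))"
    and recursive_weight: "recursive (\<lambda>n. weight (str_decode (p1 n)) (p2 n))"
begin

lemma decidable_in_open [recursive_intros]:
  assumes "string_recursive f" shows "decidable (\<lambda>n. in_open (f n))"
proof -
  have "enum t = Some z \<longleftrightarrow> encode (enum t) = Suc (encode z)" for t z
    by (cases "enum t") (simp_all add: encode_option_def inj_eq[OF inj_encode])
  then have "decidable (\<lambda>n. in_open (str_decode n))"
    unfolding in_open_def
    by (simp only:) (intro recursive_intros recursive_comp[OF recursive_enum])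
  from decidable_comp[OF this recursive_str_code[OF assms]] show ?thesis by simp
qed

lemma recursive_weight' [recursive_intros]:
  assumes "string_recursive f" "recursive g" shows "recursive (\<lambda>n. weight (f n) (g n))"
  using recursive_comp[OF recursive_weight, of "\<lambda>n. prod_encode (str_code (f n), g n)"] assms
  by (simp add: recursive_intros)

text \<open>The rules for bounded sums replace \<open>n\<close> by \<open>p1 z\<close> in the body.
  With concrete projections as arguments the introduction rules survive this; arbitrary recursive
  arguments are substituted afterwards. The next lemmas follow the same pattern.\<close>

lemma decidable_test [recursive_intros]:
  assumes "recursive e" "string_recursive y" "recursive s"
  shows "decidable (\<lambda>n. test (e n) (y n) (s n))"
proof -
  have "decidable (\<lambda>n. test (p1 n) (str_decode (p1 (p2 n))) (p2 (p2 n)))"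
    unfolding test_def sum_strings heavy_def visits_def by (intro recursive_intros)
  from decidable_comp[OF this, of "\<lambda>n. prod_encode (e n, prod_encode (str_code (y n), s n))"] assms
  show ?thesis by (simp add: recursive_intros)
qed

lemma decidable_good [recursive_intros]:
  assumes "recursive e" "string_recursive y" "string_recursive x"
  shows "decidable (\<lambda>n. good (e n) (y n) (x n))"
proof -
  have "decidable (\<lambda>n. good (p1 n) (str_decode (p1 (p2 n))) (str_decode (p2 (p2 n))))"
    unfolding good_def by (intro recursive_intros)
  from decidable_comp[OF this, of "\<lambda>n. prod_encode (e n, prod_encode (str_code (y n), str_code (x n)))"] assms
  show ?thesis by (simp add: recursive_intros)
qed

lemma recursive_next_pos [recursive_intros]:
  assumes "recursive e" "string_recursive x" "recursive i"
  shows "recursive (\<lambda>n. next_pos (e n) (x n) (i n))"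
proof -
  have "recursive (\<lambda>n. next_pos (p1 n) (str_decode (p1 (p2 n))) (p2 (p2 n)))"
    \<comment> \<open>The search always ends, at \<open>length x + 1\<close> at the latest.\<close>
    unfolding next_pos_def by (intro recursive_Least recursive_intros) blast
  from recursive_comp[OF this, of "\<lambda>n. prod_encode (e n, prod_encode (str_code (x n), i n))"] assms
  show ?thesis by (simp add: recursive_intros)
qed

lemma recursive_pos [recursive_intros]:
  assumes "recursive e" "recursive k" "string_recursive x"
  shows "recursive (\<lambda>n. pos (e n) (k n) (x n))"
proof -
  have "recursive (\<lambda>n. pos (p1 n) (p1 (p2 n)) (str_decode (p2 (p2 n))))"
    unfolding pos_def by (intro recursive_rec_nat recursive_intros)
  from recursive_comp[OF this, of "\<lambda>n. prod_encode (e n, prod_encode (k n, str_code (x n)))"] assms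
  show ?thesis by (simp add: recursive_intros)
qed

text \<open>Membership in a level is decidable, so the enumeration reads its step number as a string
  and outputs that string if it belongs to the level.\<close>

lemma uniformly_comp_enumerable_level:
  assumes "recursive E" "recursive k"
  shows "uniformly_comp_enumerable (\<lambda>i :: 'i :: coded. level (E (encode i)) (k (encode i)))"
proof -
  define f where "f z = (let x = str_decode (snd z) in
    if pos (E (encode (fst z))) (k (encode (fst z))) x = length x then Some x else None)"
    for z :: "'i \<times> nat"
  let ?g = "\<lambda>n. if pos (E (p1 n)) (k (p1 n)) (str_decode (p2 n)) = length (str_decode (p2 n))
    then Suc (encode (str_decode (p2 n))) else 0"
  have "recursive ?g"
    by (intro recursive_intros recursive_comp[OF assms(1)] recursive_comp[OF assms(2)])
  moreover have "?g (encode z) = encode (f z)" for z :: "'i \<times> nat"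
    by (simp add: f_def Let_def encode_prod_def encode_nat_def encode_option_def)
  ultimately have "computable f"
    unfolding computable_def recursive_def by (intro exI[of _ "\<lambda>n. Some (?g n)"]) simp
  moreover have "(\<exists>t. f (i, t) = Some x) \<longleftrightarrow> x \<in> level (E (encode i)) (k (encode i))" for i x
  proof
    assume "x \<in> level (E (encode i)) (k (encode i))"
    then have "f (i, str_code x) = Some x" by (simp add: f_def Let_def level_def)
    then show "\<exists>t. f (i, t) = Some x" ..
  qed (auto simp: f_def Let_def level_def split: if_splits)
  ultimately show ?thesis
    unfolding uniformly_comp_enumerable_def by (intro exI[of _ f]) simp
qed

end

section \<open>The measure of the cover\<close>

locale effective_ergodic_map = ergodic_map M \<tau> + cover_construction mach enum weight
  for M :: "cantor measure" and \<tau> mach enum weight +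
  fixes T :: "cantor \<rightharpoonup> cantor" and A :: "cantor set"
  assumes sets_M: "sets M = sets borel"
    and T_iff: "\<And>\<omega> \<eta>. T \<omega> = Some \<eta> \<longleftrightarrow> outputs mach \<omega> \<eta>"
    and AE_iterate: "AE \<omega> in M. \<forall>n. iterate T n \<omega> = Some ((\<tau> ^^ n) \<omega>)"
    and weight: "\<And>x m. \<bar>2 ^ m * prob (cyl x) - real (weight x m)\<bar> \<le> 2"
    and A_eq: "A = (\<Union>x\<in>{x. \<exists>t. enum t = Some x}. cyl x)"
begin

lemma space_M [simp]: "space M = UNIV"
  using sets_eq_imp_space_eq[OF sets_M] by simp

lemma cyl_sets [measurable, simp]: "cyl x \<in> sets M"
  by (simp add: sets_M open_cyl)

lemma A_sets [measurable, simp]: "A \<in> sets M"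
  unfolding sets_M A_eq by (intro borel_open open_UN ballI open_cyl)

definition regular :: "cantor \<Rightarrow> bool" where
  "regular \<omega> \<longleftrightarrow> (\<forall>n. iterate T n \<omega> = Some ((\<tau> ^^ n) \<omega>))"

lemma AE_regular: "AE \<omega> in M. regular \<omega>"
  using AE_iterate by (simp add: regular_def)

lemma in_cyl_run:
  "iterate T n \<omega> = Some \<eta> \<Longrightarrow> \<eta> \<in> cyl ((run mach ^^ n) (prefix_of \<omega> l))"
  using iterate_approx[OF T_iff] by blast

lemma eventually_long_run:
  assumes "iterate T n \<omega> = Some \<eta>"
  shows "\<exists>l\<^sub>0. \<forall>l\<ge>l\<^sub>0. m \<le> length ((run mach ^^ n) (prefix_of \<omega> l))"
proof -
  obtain l\<^sub>0 where l\<^sub>0: "m \<le> length ((run mach ^^ n) (prefix_of \<omega> l\<^sub>0))"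
    using iterate_approx[OF T_iff assms] by blast
  have "m \<le> length ((run mach ^^ n) (prefix_of \<omega> l))" if "l\<^sub>0 \<le> l" for l
  proof -
    have "prefix (prefix_of \<omega> l\<^sub>0) (prefix_of \<omega> l)" using that by (simp add: prefix_prefix_of)
    from prefix_length_le[OF funpow_run_mono[OF this, where M = mach and n = n]] l\<^sub>0 show ?thesis by linarith
  qed
  then show ?thesis by blast
qed

lemma in_open_subset: "in_open z \<Longrightarrow> cyl z \<subseteq> A"
proof -
  assume "in_open z"
  then obtain t p where "enum t = Some (take p z)" by (auto simp: in_open_def)
  then have "cyl (take p z) \<subseteq> A" by (auto simp: A_eq)
  with cyl_antimono[OF take_is_prefix[of p z]] show ?thesis by simp
qed

lemma in_open_if_long:
  assumes "\<eta> \<in> A" shows "\<exists>m. \<forall>z. \<eta> \<in> cyl z \<longrightarrow> m \<le> length z \<longrightarrow> in_open z"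
proof -
  obtain t x where tx: "enum t = Some x" "\<eta> \<in> cyl x" using assms by (auto simp: A_eq)
  have "in_open z" if "\<eta> \<in> cyl z" and "max (Suc t) (length x) \<le> length z" for z
  proof -
    have "take (length x) z = x"
      using prefix_of_two_cyls[OF tx(2) that(1)] that(2) by (simp add: prefix_iff_take)
    with tx(1) that(2) show ?thesis
      unfolding in_open_def by (intro exI[of _ t] conjI exI[of _ "length x"]) simp_all
  qed
  then show ?thesis by blast
qed

text \<open>Two cylinders with a common point have comparable strings, so prefix-freeness gives
  disjointness.\<close>

lemma measure_UN_cyl:
  assumes "finite X" and "\<And>x y. x \<in> X \<Longrightarrow> y \<in> X \<Longrightarrow> prefix x y \<Longrightarrow> x = y"
  shows "prob (\<Union>x\<in>X. cyl x) = (\<Sum>x\<in>X. prob (cyl x))"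
proof (rule finite_measure_finite_Union)
  show "disjoint_family_on cyl X"
    unfolding disjoint_family_on_def
    by (metis assms(2) disjoint_iff nle_le prefix_of_two_cyls)
qed (use assms(1) in auto)

section \<open>Soundness and completeness of the frequency test\<close>

definition heavy_strings :: "nat \<Rightarrow> nat \<Rightarrow> bool list \<Rightarrow> nat \<Rightarrow> bool list set" where
  "heavy_strings e N y l = {x. length x = l \<and> heavy e N y x}"

lemma finite_heavy_strings [simp]: "finite (heavy_strings e N y l)"
  by (rule finite_subset[OF _ finite_strings[of l]]) (auto simp: heavy_strings_def)

lemma card_heavy_strings: "card (heavy_strings e N y l) \<le> 2 ^ l"
  unfolding card_strings[symmetric] by (rule card_mono) (auto simp: heavy_strings_def)

lemma measure_heavy:
  "prob (\<Union>x\<in>heavy_strings e N y l. cyl x) = (\<Sum>x\<in>heavy_strings e N y l. prob (cyl x))"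
  by (rule measure_UN_cyl) (auto simp: heavy_strings_def prefix_def)

lemma test_iff:
  "test e y s \<longleftrightarrow> 1 \<le> p1 s \<and> (\<Sum>x\<in>heavy_strings e (p1 s) y (p2 s). weight x (p2 s + e)) \<le> 3 * 2 ^ p2 s"
proof -
  have "(\<Sum>x | length x = l. if heavy e N y x then weight x (l + e) else 0)
      = (\<Sum>x\<in>heavy_strings e N y l. weight x (l + e))" for N l
    unfolding heavy_strings_def by (subst sum.inter_filter[symmetric]) simp_all
  then show ?thesis by (simp add: test_def)
qed

text \<open>At a true visit, \<open>y\<close> and the computed part of the iterate are prefixes of
  the same point and hence comparable.\<close>

lemma visits_ge_birkhoff:
  assumes "regular \<omega>"
  shows "birkhoff (indicator (cyl y)) N \<omega> \<le> real (visits N y (prefix_of \<omega> l))"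
  unfolding birkhoff_def visits_def of_nat_sum
proof (rule sum_mono)
  fix n
  let ?z = "(run mach ^^ n) (prefix_of \<omega> l)"
  have z: "(\<tau> ^^ n) \<omega> \<in> cyl ?z" using assms in_cyl_run by (simp add: regular_def)
  have "take (length ?z) y = take (length y) ?z" if "(\<tau> ^^ n) \<omega> \<in> cyl y"
    using prefix_of_two_cyls[OF z that] prefix_of_two_cyls[OF that z]
    by (cases "length ?z \<le> length y") (auto simp: prefix_iff_take)
  then show "indicat_real (cyl y) ((\<tau> ^^ n) \<omega>) \<le> real (of_bool (take (length ?z) y = take (length y) ?z))"
    by (simp add: indicator_def)
qed

text \<open>Once all \<open>N\<close> computed iterates are at least as long as \<open>y\<close>,
  being comparable with \<open>y\<close> means extending it.\<close>

lemma visits_eventually_le: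
  assumes "regular \<omega>"
  shows "\<exists>l\<^sub>0. \<forall>l\<ge>l\<^sub>0. real (visits N y (prefix_of \<omega> l)) \<le> birkhoff (indicator (cyl y)) N \<omega>"
proof -
  have "\<forall>n. \<exists>l\<^sub>0. \<forall>l\<ge>l\<^sub>0. length y \<le> length ((run mach ^^ n) (prefix_of \<omega> l))"
    using assms eventually_long_run by (simp add: regular_def)
  then obtain f where f: "\<And>n l. f n \<le> l \<Longrightarrow> length y \<le> length ((run mach ^^ n) (prefix_of \<omega> l))"
    by metis
  have "real (visits N y (prefix_of \<omega> l)) \<le> birkhoff (indicator (cyl y)) N \<omega>" if l: "(\<Sum>n<N. f n) \<le> l" for l
    unfolding birkhoff_def visits_def of_nat_sum
  proof (rule sum_mono)
    fix n assume "n \<in> {..<N}"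
    let ?z = "(run mach ^^ n) (prefix_of \<omega> l)"
    have "f n \<le> l" using member_le_sum[OF \<open>n \<in> _\<close>, of f] l by simp
    from f[OF this] have len: "length y \<le> length ?z" .
    have z: "(\<tau> ^^ n) \<omega> \<in> cyl ?z" using assms in_cyl_run by (simp add: regular_def)
    have "(\<tau> ^^ n) \<omega> \<in> cyl y" if "take (length ?z) y = take (length y) ?z"
    proof -
      have "prefix y ?z" using that len by (simp add: prefix_iff_take)
      with z cyl_antimono show ?thesis by blast
    qed
    then show "real (of_bool (take (length ?z) y = take (length y) ?z)) \<le> indicat_real (cyl y) ((\<tau> ^^ n) \<omega>)"
      by (simp add: indicator_def)
  qed
  then show ?thesis by blast
qed

lemma weight_threshold:
  "prob (cyl y) + 1 / 2 ^ e \<le> (real (weight y e) + 3) / 2 ^ e"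
  "(real (weight y e) + 3) / 2 ^ e \<le> prob (cyl y) + 5 / 2 ^ e"
proof -
  have "2 ^ e * prob (cyl y) + 1 \<le> real (weight y e) + 3"
    "real (weight y e) + 3 \<le> 2 ^ e * prob (cyl y) + 5"
    using weight[of e y] by linarith+
  from divide_right_mono[OF this(1), of "2 ^ e"] divide_right_mono[OF this(2), of "2 ^ e"]
  show "prob (cyl y) + 1 / 2 ^ e \<le> (real (weight y e) + 3) / 2 ^ e"
    "(real (weight y e) + 3) / 2 ^ e \<le> prob (cyl y) + 5 / 2 ^ e"
    by (simp_all add: add_divide_distrib)
qed

lemma heavy_iff:
  "heavy e N y x \<longleftrightarrow> (real (weight y e) + 3) / 2 ^ e * real N < real (visits N y x)"
proof -
  have "heavy e N y x \<longleftrightarrow> real ((weight y e + 3) * N) < real (2 ^ e * visits N y x)"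
    unfolding heavy_def of_nat_less_iff ..
  then show ?thesis by (simp add: field_simps)
qed

lemma measure_heavy_le:
  assumes "test e y s"
  shows "prob (\<Union>x\<in>heavy_strings e (p1 s) y (p2 s). cyl x) \<le> 5 / 2 ^ e"
proof -
  let ?l = "p2 s" and ?H = "heavy_strings e (p1 s) y (p2 s)"
  have "2 ^ (?l + e) * (\<Sum>x\<in>?H. prob (cyl x)) = (\<Sum>x\<in>?H. 2 ^ (?l + e) * prob (cyl x))"
    by (rule sum_distrib_left)
  also have "\<dots> \<le> (\<Sum>x\<in>?H. real (weight x (?l + e)) + 2)"
  proof (rule sum_mono)
    fix x
    show "2 ^ (?l + e) * prob (cyl x) \<le> real (weight x (?l + e)) + 2"
      using weight[of "?l + e" x] by linarith
  qed
  also have "\<dots> = real (\<Sum>x\<in>?H. weight x (?l + e)) + 2 * real (card ?H)"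
    by (simp add: sum.distrib)
  also have "\<dots> \<le> real (3 * 2 ^ ?l) + 2 * real (2 ^ ?l)"
    using assms card_heavy_strings[of e "p1 s" y ?l] unfolding test_iff
    by (intro add_mono mult_left_mono of_nat_mono) simp_all
  finally have "2 ^ ?l * (2 ^ e * (\<Sum>x\<in>?H. prob (cyl x))) \<le> 2 ^ ?l * 5"
    by (simp add: power_add mult.assoc)
  then have "2 ^ e * (\<Sum>x\<in>?H. prob (cyl x)) \<le> 5" by simp
  then show ?thesis unfolding measure_heavy by (simp add: field_simps)
qed

lemma test_sound:
  assumes test: "test e y s" and V [measurable]: "V \<in> sets M" and Vy: "V \<subseteq> cyl y"
    and VA: "\<And>\<omega> n. \<omega> \<in> V \<Longrightarrow> regular \<omega> \<Longrightarrow> n < p1 s \<Longrightarrow> (\<tau> ^^ n) \<omega> \<in> A"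
  shows "prob V \<le> prob A * prob (cyl y) + 10 / 2 ^ e"
proof -
  let ?N = "p1 s" and ?q = "(real (weight y e) + 3) / 2 ^ e"
  let ?H = "\<Union>x\<in>heavy_strings e (p1 s) y (p2 s). cyl x"
  \<comment> \<open>Overcounting puts only regular points with too many visits into the heavy
    cylinders; a measurable null set takes up the others.\<close>
  obtain Z where Z: "{\<omega>\<in>space M. \<not> regular \<omega>} \<subseteq> Z" "emeasure M Z = 0" "Z \<in> sets M"
    using AE_E[OF AE_regular] .
  have H: "?H \<in> sets M" by (intro sets.finite_UN) simp_all
  have "{\<omega>\<in>space M. ?q * real ?N < birkhoff (indicator (cyl y)) ?N \<omega>} \<subseteq> ?H \<union> Z"
  proof
    fix \<omega> assume \<omega>: "\<omega> \<in> {\<omega>\<in>space M. ?q * real ?N < birkhoff (indicator (cyl y)) ?N \<omega>}"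
    show "\<omega> \<in> ?H \<union> Z"
    proof (cases "regular \<omega>")
      case True
      from visits_ge_birkhoff[OF this, of y ?N "p2 s"] \<omega>
      have "prefix_of \<omega> (p2 s) \<in> heavy_strings e ?N y (p2 s)"
        by (simp add: heavy_strings_def heavy_iff)
      then show ?thesis by force
    qed (use Z(1) in auto)
  qed
  then have "(\<Sum>n<?N. prob (cyl y \<inter> (\<tau> ^^ n) -` A)) \<le> real ?N * (?q * prob A + prob (?H \<union> Z))"
    using H Z(3) by (intro sum_measure_inter_vimage_le) auto
  moreover have "prob V \<le> prob (cyl y \<inter> (\<tau> ^^ n) -` A)" if "n < ?N" for n
  proof (rule finite_measure_mono_AE)
    show "AE \<omega> in M. \<omega> \<in> V \<longrightarrow> \<omega> \<in> cyl y \<inter> (\<tau> ^^ n) -` A"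
      using AE_regular by eventually_elim (use Vy VA that in auto)
    show "cyl y \<inter> (\<tau> ^^ n) -` A \<in> sets M"
      using measurable_sets[OF measurable_funpow_map A_sets, of n] by auto
  qed
  then have "(\<Sum>n<?N. prob V) \<le> (\<Sum>n<?N. prob (cyl y \<inter> (\<tau> ^^ n) -` A))"
    by (intro sum_mono) simp
  ultimately have "real ?N * prob V \<le> real ?N * (?q * prob A + prob (?H \<union> Z))"
    by simp
  then have "prob V \<le> ?q * prob A + prob (?H \<union> Z)"
    using test by (simp add: test_iff)
  also have "prob (?H \<union> Z) \<le> 5 / 2 ^ e"
    using measure_Un_le[OF H Z(3)] measure_heavy_le[OF test] Z(2) by (simp add: measure_def)
  also have "?q * prob A \<le> (prob (cyl y) + 5 / 2 ^ e) * prob A"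
    by (intro mult_right_mono weight_threshold) simp
  also have "\<dots> \<le> prob A * prob (cyl y) + 5 / 2 ^ e"
    using mult_left_mono[of "prob A" 1 "5 / 2 ^ e"] by (simp add: algebra_simps)
  finally show ?thesis by simp
qed

text \<open>The ergodic theorem bounds the measure of the true exceptional set \<open>D\<close>. As
  inputs grow, the counted visits become the true ones at almost every point, so the excess of the
  heavy cylinders over \<open>D\<close> vanishes in measure.\<close>

lemma test_complete: "\<exists>s. test e y s"
proof -
  let ?q = "(real (weight y e) + 3) / 2 ^ e" and ?B = "birkhoff (indicator (cyl y))"
  obtain N where "1 \<le> N"
    and N: "prob {\<omega>\<in>space M. (prob (cyl y) + 1 / 2 ^ e) * real N \<le> ?B N \<omega>} < 1 / 2 ^ e"
    using ergodic_in_probability[of "cyl y" "1 / 2 ^ e" "1 / 2 ^ e"] by auto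
  let ?H = "\<lambda>l. \<Union>x\<in>heavy_strings e N y l. cyl x"
  define D where "D = {\<omega>\<in>space M. (prob (cyl y) + 1 / 2 ^ e) * real N \<le> ?B N \<omega>}"
  have D [measurable]: "D \<in> sets M" unfolding D_def by measurable
  have H [measurable]: "?H l \<in> sets M" for l by (intro sets.finite_UN) simp_all
  have "(\<lambda>l. \<integral>\<omega>. indicat_real (?H l - D) \<omega> \<partial>M) \<longlonglongrightarrow> (\<integral>\<omega>. 0 \<partial>M)"
  proof (rule integral_dominated_convergence[where w = "\<lambda>_. 1"])
    show "AE \<omega> in M. (\<lambda>l. indicat_real (?H l - D) \<omega>) \<longlonglongrightarrow> 0"
      using AE_regular
    proof eventually_elim
      fix \<omega> assume "regular \<omega>"
      from visits_eventually_le[OF this, of N y] obtain l\<^sub>0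
        where l\<^sub>0: "\<And>l. l\<^sub>0 \<le> l \<Longrightarrow> real (visits N y (prefix_of \<omega> l)) \<le> ?B N \<omega>" by blast
      have "indicat_real (?H l - D) \<omega> = 0" if "l\<^sub>0 \<le> l" for l
      proof -
        have "\<omega> \<in> D" if "\<omega> \<in> ?H l"
        proof -
          from that have "prefix_of \<omega> l \<in> heavy_strings e N y l"
            by (auto simp: heavy_strings_def prefix_of_eq_iff[symmetric])
          then have "?q * real N < real (visits N y (prefix_of \<omega> l))"
            by (simp add: heavy_strings_def heavy_iff)
          moreover have "(prob (cyl y) + 1 / 2 ^ e) * real N \<le> ?q * real N"
            by (intro mult_right_mono weight_threshold) simp
          ultimately show ?thesis using l\<^sub>0[OF \<open>l\<^sub>0 \<le> l\<close>] by (simp add: D_def)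
        qed
        then show ?thesis by (auto simp: indicator_def)
      qed
      then show "(\<lambda>l. indicat_real (?H l - D) \<omega>) \<longlonglongrightarrow> 0"
        by (intro tendsto_eventually eventually_sequentiallyI)
    qed
  qed (auto simp: indicator_def)
  then have "(\<lambda>l. prob (?H l - D)) \<longlonglongrightarrow> 0" by simp
  \<comment> \<open>The strict bound on \<open>D\<close> leaves room for the excess.\<close>
  moreover have "0 < 1 / 2 ^ e - prob D" using N by (simp add: D_def)
  ultimately have "\<forall>\<^sub>F l in sequentially. prob (?H l - D) < 1 / 2 ^ e - prob D"
    by (rule order_tendstoD)
  then obtain l where l: "prob (?H l - D) < 1 / 2 ^ e - prob D"
    by (auto simp: eventually_sequentially)
  have "prob (?H l) \<le> prob ((?H l - D) \<union> D)"
    by (rule finite_measure_mono) auto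
  also have "\<dots> \<le> prob (?H l - D) + prob D" by (rule measure_Un_le) auto
  finally have "prob (?H l) \<le> 1 / 2 ^ e" using l by linarith
  then have le: "2 ^ (l + e) * (\<Sum>x\<in>heavy_strings e N y l. prob (cyl x)) \<le> 2 ^ l"
    unfolding measure_heavy by (simp add: power_add field_simps)
  have "real (\<Sum>x\<in>heavy_strings e N y l. weight x (l + e))
      \<le> (\<Sum>x\<in>heavy_strings e N y l. 2 ^ (l + e) * prob (cyl x) + 2)"
    unfolding of_nat_sum
  proof (rule sum_mono)
    fix x
    show "real (weight x (l + e)) \<le> 2 ^ (l + e) * prob (cyl x) + 2"
      using weight[of "l + e" x] by linarith
  qed
  also have "\<dots> = 2 ^ (l + e) * (\<Sum>x\<in>heavy_strings e N y l. prob (cyl x)) + 2 * real (card (heavy_strings e N y l))"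
    by (simp add: sum.distrib sum_distrib_left)
  also have "\<dots> \<le> 2 ^ l + 2 * real (2 ^ l)"
    using le card_heavy_strings[of e N y l] by (intro add_mono mult_left_mono of_nat_mono) simp_all
  also have "\<dots> = real (3 * 2 ^ l)" by simp
  finally have "test e y (prod_encode (N, l))"
    using \<open>1 \<le> N\<close> unfolding test_iff of_nat_le_iff by simp
  then show ?thesis ..
qed

text \<open>The number of iterates demanded is fixed by the current prefix, and each of these
  iterates is seen to lie in \<open>A\<close> after finitely many bits of
  \<open>\<omega>\<close>.\<close>

lemma always_in_covered:
  assumes "\<omega> \<in> always_in T A"
  shows "\<exists>l. prefix_of \<omega> l \<in> level E k"
proof (induction k)
  case 0
  show ?case by (rule exI[of _ 0]) (simp add: level_def prefix_of_def)
next
  case (Suc k)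
  then obtain i where i: "prefix_of \<omega> i \<in> level E k" by blast
  let ?y = "prefix_of \<omega> i"
  let ?e = "str_code ?y + E"
  define s where "s = (LEAST s. test ?e ?y s)"
  have s: "test ?e ?y s" unfolding s_def using test_complete by (rule LeastI_ex)
  have s': "\<not> test ?e ?y s'" if "s' < s" for s' using that unfolding s_def by (rule not_less_Least)
  have "\<exists>l. in_open ((run mach ^^ n) (prefix_of \<omega> l))" for n
  proof -
    obtain \<eta> where \<eta>: "iterate T n \<omega> = Some \<eta>" "\<eta> \<in> A" using assms by (auto simp: always_in_def)
    obtain m where m: "\<And>z. \<eta> \<in> cyl z \<Longrightarrow> m \<le> length z \<Longrightarrow> in_open z"
      using in_open_if_long[OF \<eta>(2)] by blast
    from eventually_long_run[OF \<eta>(1), of m] m in_cyl_run[OF \<eta>(1)] show ?thesis by blast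
  qed
  then obtain f where f: "\<And>n. in_open ((run mach ^^ n) (prefix_of \<omega> (f n)))" by metis
  \<comment> \<open>The summand \<open>i\<close> keeps \<open>j\<close> beyond the old position,
    \<open>s\<close> meets the bound \<open>s \<le> length x\<close> in \<open>good\<close>, and the
    sum dominates every \<open>f n\<close>.\<close>
  define j where "j = i + s + (\<Sum>n<p1 s. f n)"
  have "in_open ((run mach ^^ n) (prefix_of \<omega> j))" if "n < p1 s" for n
  proof (rule in_open_mono[OF funpow_run_mono f])
    have "f n \<le> (\<Sum>n<p1 s. f n)" using that by (intro member_le_sum) auto
    then show "prefix (prefix_of \<omega> (f n)) (prefix_of \<omega> j)" by (simp add: prefix_prefix_of j_def)
  qed
  with s s' have "good ?e ?y (prefix_of \<omega> j)"
    unfolding good_def by (intro exI[of _ s]) (simp add: j_def)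
  then show ?case using i by (intro level_Suc_I[of \<omega> i E k j]) (auto simp: j_def)
qed

text \<open>Cutting off at \<open>L\<close> makes the sums finite and is compatible with the
  recursion, since the string preceding \<open>x\<close> on the previous level is no longer than
  \<open>x\<close>.\<close>

definition level_mass :: "nat \<Rightarrow> nat \<Rightarrow> nat \<Rightarrow> real" where
  "level_mass E k L = (\<Sum>x\<in>{x\<in>level E k. length x \<le> L}. prob (cyl x))"

lemma finite_level_le [simp]: "finite {x \<in> level E k. length x \<le> L}"
  by (rule finite_subset[OF _ finite_strings_le[of L]]) auto

lemma level_mass_eq: "level_mass E k L = prob (\<Union>x\<in>{x\<in>level E k. length x \<le> L}. cyl x)"
  unfolding level_mass_def by (rule measure_UN_cyl[symmetric]) (auto intro: level_antichain)

text \<open>Strings are grouped by their prefix \<open>y\<close> on the previous level, and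
  \<open>test_sound\<close> is applied to each group. The errors
  \<open>10 / 2 ^ (str_code y + E)\<close> add up to at most \<open>20 / 2 ^ E\<close>.\<close>

lemma level_mass_Suc_le: "level_mass E (Suc k) L \<le> prob A * level_mass E k L + 20 / 2 ^ E"
proof -
  let ?X = "{x\<in>level E (Suc k). length x \<le> L}" and ?Y = "{y\<in>level E k. length y \<le> L}"
  define par where "par x = take (pos E k x) x" for x
  have par: "par x \<in> ?Y" if "x \<in> ?X" for x
    using that level_Suc_D(1)[of x E k] by (auto simp: par_def)
  have "(\<Sum>x\<in>{x\<in>?X. par x = y}. prob (cyl x)) \<le> prob A * prob (cyl y) + 10 / 2 ^ (str_code y + E)" for y
  proof (cases "{x\<in>?X. par x = y} = {}")
    case False
    let ?e = "str_code y + E"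
    have good: "prefix y x" "good ?e y x" if "x \<in> ?X" "par x = y" for x
      using that level_Suc_D(2,3)[of x E k] by (auto simp: par_def)
    with False obtain s where s: "test ?e y s" "\<And>s'. s' < s \<Longrightarrow> \<not> test ?e y s'"
      unfolding good_def by blast
    have "(\<Sum>x\<in>{x\<in>?X. par x = y}. prob (cyl x)) = prob (\<Union>x\<in>{x\<in>?X. par x = y}. cyl x)"
      by (rule measure_UN_cyl[symmetric]) (auto intro: level_antichain)
    also have "\<dots> \<le> prob A * prob (cyl y) + 10 / 2 ^ ?e"
    proof (rule test_sound[OF s(1)])
      show "(\<Union>x\<in>{x\<in>?X. par x = y}. cyl x) \<in> sets M"
        by (intro sets.finite_UN) simp_all
      show "(\<Union>x\<in>{x\<in>?X. par x = y}. cyl x) \<subseteq> cyl y"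
        using good(1) cyl_antimono by blast
    next
      fix \<omega> n assume "\<omega> \<in> (\<Union>x\<in>{x\<in>?X. par x = y}. cyl x)" and "regular \<omega>" and n: "n < p1 s"
      then obtain x where x: "x \<in> ?X" "par x = y" "\<omega> \<in> cyl x" by blast
      obtain s\<^sub>x where "test ?e y s\<^sub>x" "\<forall>s'<s\<^sub>x. \<not> test ?e y s'"
        and open_x: "\<forall>n<p1 s\<^sub>x. in_open ((run mach ^^ n) x)"
        using good(2)[OF x(1,2)] by (auto simp: good_def)
      \<comment> \<open>The first passed test depends on \<open>y\<close> and the precision only, so
        the whole group shares one number of iterates.\<close>
      with s have "s\<^sub>x = s" by (meson nat_neq_iff)
      with open_x n have "cyl ((run mach ^^ n) x) \<subseteq> A" by (intro in_open_subset) simp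
      moreover have "(\<tau> ^^ n) \<omega> \<in> cyl ((run mach ^^ n) x)"
        using in_cyl_run[of n \<omega> "(\<tau> ^^ n) \<omega>" "length x"] \<open>regular \<omega>\<close> x(3)
        by (simp add: regular_def prefix_of_eq_iff[THEN iffD2])
      ultimately show "(\<tau> ^^ n) \<omega> \<in> A" by blast
    qed
    finally show ?thesis .
  next
    case True
    then show ?thesis by (simp only: sum.empty) simp
  qed
  then have "(\<Sum>y\<in>?Y. \<Sum>x\<in>{x\<in>?X. par x = y}. prob (cyl x))
      \<le> (\<Sum>y\<in>?Y. prob A * prob (cyl y) + 10 / 2 ^ (str_code y + E))"
    by (intro sum_mono)
  moreover have "(\<Sum>y\<in>?Y. \<Sum>x\<in>{x\<in>?X. par x = y}. prob (cyl x)) = level_mass E (Suc k) L"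
    unfolding level_mass_def by (rule sum.group) (use par in auto)
  moreover have "(\<Sum>y\<in>?Y. prob A * prob (cyl y) + 10 / 2 ^ (str_code y + E))
      = prob A * level_mass E k L + 10 / 2 ^ E * (\<Sum>y\<in>?Y. (1 / 2) ^ str_code y)"
  proof -
    have "10 / 2 ^ (str_code y + E) = 10 / 2 ^ E * (1 / 2 :: real) ^ str_code y" for y
      by (simp add: power_add power_divide)
    then show ?thesis by (simp only: level_mass_def sum.distrib sum_distrib_left)
  qed
  moreover have "10 / 2 ^ E * (\<Sum>y\<in>?Y. (1 / 2) ^ str_code y) \<le> 10 / 2 ^ E * (2 :: real)"
    by (intro mult_left_mono sum_half_power_str_code_le) simp_all
  ultimately show ?thesis by simp
qed

lemma level_mass_le: "level_mass E k L \<le> prob A ^ k + real k * (20 / 2 ^ E)"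
proof (induction k)
  case 0
  show ?case by (simp add: level_mass_eq)
next
  case (Suc k)
  define \<delta> :: real where "\<delta> = 20 / 2 ^ E"
  have "level_mass E (Suc k) L \<le> prob A * (prob A ^ k + real k * \<delta>) + \<delta>"
    using level_mass_Suc_le[of E k L] mult_left_mono[OF Suc, of "prob A"] by (simp add: \<delta>_def)
  moreover have "prob A * (real k * \<delta>) \<le> real k * \<delta>"
    by (rule mult_left_le_one_le) (simp_all add: \<delta>_def)
  ultimately have "level_mass E (Suc k) L \<le> prob A ^ Suc k + real (Suc k) * \<delta>"
    by (simp add: algebra_simps)
  then show ?case by (simp only: \<delta>_def)
qed

lemma measure_level_le: "prob (\<Union>x\<in>level E k. cyl x) \<le> prob A ^ k + real k * (20 / 2 ^ E)"
proof -
  let ?U = "\<lambda>L. \<Union>x\<in>{x\<in>level E k. length x \<le> L}. cyl x"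
  have "incseq ?U" by (force simp: incseq_def)
  moreover have "range ?U \<subseteq> sets M" by (auto intro!: sets.finite_UN)
  ultimately have "(\<lambda>L. prob (?U L)) \<longlonglongrightarrow> prob (\<Union>L. ?U L)"
    by (intro finite_Lim_measure_incseq)
  moreover have "(\<Union>L. ?U L) = (\<Union>x\<in>level E k. cyl x)" by auto
  ultimately show ?thesis
    using level_mass_le[of E k] unfolding level_mass_eq by (intro LIMSEQ_le_const2) auto
qed

end

section \<open>Approximating the measure of cylinders\<close>

lemma recursive_computable:
  assumes "computable f" and "recursive (\<lambda>n. encode (h n))"
  shows "recursive (\<lambda>n. encode (f (h n)))"
proof -
  obtain g where "partrec g" "\<And>x. g (encode x) = Some (encode (f x))"
    using assms(1) by (auto simp: computable_def)
  with partrec.comp[of g "\<lambda>n. Some (encode (h n))"] assms(2) show ?thesis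
    by (simp add: recursive_def)
qed

text \<open>The floor of \<open>2 ^ m * max 0 q\<close>, read off the code of \<open>q\<close>:
  \<open>int_encode\<close> sends \<open>i \<ge> 0\<close> to \<open>2 * i\<close> and negative
  numbers to odd ones, and the denominator is positive.\<close>

definition scaled_floor :: "nat \<Rightarrow> nat \<Rightarrow> nat" where
  "scaled_floor m c = (if p1 c mod 2 = 1 then 0 else (p1 c div 2 * 2 ^ m) div (p2 c div 2))"

lemma scaled_floor:
  "\<bar>2 ^ m * max 0 (real_of_rat q) - real (scaled_floor m (encode q))\<bar> \<le> 1"
proof -
  obtain a b where q: "quotient_of q = (a, b)" by (cases "quotient_of q")
  then have "0 < b" using quotient_of_denom_pos by blast
  have q_eq: "real_of_rat q = of_int a / of_int b"
    using quotient_of_div[OF q] by (simp add: of_rat_divide)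
  have enc: "p1 (encode q) = int_encode a" "p2 (encode q) = int_encode b"
    by (simp_all add: encode_rat_def q)
  have b: "int_encode b div 2 = nat b" using \<open>0 < b\<close> by (simp add: int_encode_def sum_encode_def)
  show ?thesis
  proof (cases "0 \<le> a")
    case True
    then have "scaled_floor m (encode q) = nat a * 2 ^ m div nat b"
      unfolding scaled_floor_def enc b by (simp add: int_encode_def sum_encode_def)
    moreover have "2 ^ m * max 0 (real_of_rat q) = real (nat a * 2 ^ m) / real (nat b)"
      using True \<open>0 < b\<close> by (simp add: q_eq max_def zero_le_divide_iff)
    moreover have "\<bar>real u / real v - real (u div v)\<bar> \<le> 1" if "0 < v" for u v :: nat
      using that of_nat_of_nat_div_aux[of u v, where ?'a = real] mod_less_divisor[OF that, of u]
      by (simp add: divide_le_eq_1)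
    ultimately show ?thesis using \<open>0 < b\<close> by (simp only: zero_less_nat_eq)
  next
    case False
    then have "scaled_floor m (encode q) = 0"
      unfolding scaled_floor_def enc by (simp add: int_encode_def sum_encode_def)
    moreover have "real_of_rat q \<le> 0"
      using False \<open>0 < b\<close> by (simp add: q_eq divide_le_0_iff)
    ultimately show ?thesis by (simp add: max_def)
  qed
qed

text \<open>The rational approximation and the floor each cost 1 at scale \<open>2 ^ m\<close>;
  replacing negative approximations by 0 does not increase the error.\<close>

lemma exists_weight:
  assumes "computable_measure \<mu>"
  obtains weight where "recursive (\<lambda>n. weight (str_decode (p1 n)) (p2 n))"
    and "\<And>x m. \<bar>2 ^ m * measure \<mu> (cyl x) - real (weight x m)\<bar> \<le> 2"
proof -
  obtain f :: "bool list \<times> nat \<Rightarrow> rat" where f: "computable f"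
    "\<And>x m. \<bar>measure \<mu> (cyl x) - real_of_rat (f (x, m))\<bar> \<le> 1 / 2 ^ m"
    using assms by (auto simp: computable_measure_def)
  define weight where "weight x m = scaled_floor m (encode (f (x, m)))" for x m
  have "recursive (\<lambda>n. encode (str_decode (p1 n), p2 n))"
    unfolding encode_prod_def encode_nat_def fst_conv snd_conv by (intro recursive_intros)
  from recursive_computable[OF f(1) this]
  have "recursive (\<lambda>n. weight (str_decode (p1 n)) (p2 n))"
    unfolding weight_def scaled_floor_def by (intro recursive_intros)
  moreover have "\<bar>2 ^ m * measure \<mu> (cyl x) - real (weight x m)\<bar> \<le> 2" for x m
  proof -
    let ?q = "real_of_rat (f (x, m))"
    have "\<bar>measure \<mu> (cyl x) - max 0 ?q\<bar> \<le> 1 / 2 ^ m"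
    proof -
      have "\<bar>u - max 0 v\<bar> \<le> \<bar>u - v\<bar>" if "0 \<le> u" for u v :: real
        using that by (simp add: max_def)
      from this[OF measure_nonneg] f(2)[of x m] show ?thesis by (rule order_trans)
    qed
    then have "2 ^ m * \<bar>measure \<mu> (cyl x) - max 0 ?q\<bar> \<le> 2 ^ m * (1 / 2 ^ m)"
      by (rule mult_left_mono) simp
    then have "\<bar>2 ^ m * measure \<mu> (cyl x) - 2 ^ m * max 0 ?q\<bar> \<le> 1"
      by (simp add: right_diff_distrib[symmetric] abs_mult)
    then show ?thesis
      using scaled_floor[of m "f (x, m)"] unfolding weight_def by linarith
  qed
  ultimately show ?thesis by (rule that)
qed

section \<open>Total extension of an almost everywhere defined map\<close>

text \<open>Undefined points are kept fixed, so that by \<open>vimage_total\<close> preimages of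
  measurable sets remain measurable.\<close>

definition total :: "('a \<rightharpoonup> 'a) \<Rightarrow> 'a \<Rightarrow> 'a" where
  "total T \<omega> = (case T \<omega> of None \<Rightarrow> \<omega> | Some \<eta> \<Rightarrow> \<eta>)"

lemma vimage_total: "total T -` B = pre T B \<union> (B - dom T)"
  by (auto simp: total_def pre_def split: option.splits)

context prob_space
begin

text \<open>Preimages under \<open>T\<close> and \<open>total T\<close> differ only outside
  \<open>dom T\<close>, a null set, so a set invariant under \<open>total T\<close> is invariant up
  to a null set under \<open>T\<close>.\<close>

lemma ergodic_map_total:
  assumes space: "space M = UNIV" and dom: "ae_defined M T"
    and mp: "measure_preserving M T" and erg: "ergodic M T"
  shows "ergodic_map M (total T)"
proof -
  have dom_sets [measurable]: "dom T \<in> sets M" and dom_AE: "AE \<omega> in M. \<omega> \<in> dom T"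
    using dom AE_prob_1[of "dom T"] by (simp_all add: ae_defined_def)
  have pre: "pre T B \<in> sets M" "prob (pre T B) = prob B" if "B \<in> sets M" for B
    using mp that by (simp_all add: measure_preserving_def)
  have vimage: "total T -` B \<in> sets M" if "B \<in> sets M" for B
    unfolding vimage_total using pre(1)[OF that] that by auto
  have meas: "total T \<in> measurable M M"
    by (rule measurableI) (use vimage in \<open>auto simp: space\<close>)
  have "distr M M (total T) = M"
  proof (rule measure_eqI)
    fix B assume "B \<in> sets (distr M M (total T))"
    then have B: "B \<in> sets M" by simp
    have "prob (total T -` B) = prob (pre T B)"
      by (rule finite_measure_eq_AE) (use dom_AE vimage[OF B] pre(1)[OF B] in \<open>auto simp: vimage_total\<close>)
    then show "emeasure (distr M M (total T)) B = emeasure M B"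
      by (simp add: emeasure_distr[OF meas B] emeasure_eq_measure space pre(2)[OF B])
  qed simp
  moreover have "prob B = 0 \<or> prob B = 1"
    if B: "B \<in> sets M" and inv: "total T -` B \<inter> space M = B" for B
  proof -
    have "(pre T B - B) \<union> (B - pre T B) \<subseteq> UNIV - dom T"
      using inv by (auto simp: vimage_total space)
    moreover have "UNIV - dom T \<in> null_sets M"
      using dom_AE by (subst AE_iff_null_sets) (auto simp: space[symmetric])
    moreover have "(pre T B - B) \<union> (B - pre T B) \<in> sets M"
      by (intro sets.Un sets.Diff pre(1) B)
    ultimately have "(pre T B - B) \<union> (B - pre T B) \<in> null_sets M"
      by (rule null_sets_subset[rotated 2])
    then have "prob B \<in> {0, 1}" using erg B unfolding ergodic_def by blast
    then show ?thesis by simp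
  qed
  ultimately show ?thesis
    by unfold_locales (use meas in auto)
qed

end

text \<open>Each power of \<open>\<tau>\<close> preserves the measure and so avoids the null
  complement of \<open>dom T\<close> almost everywhere; there are only countably many
  powers.\<close>

lemma (in measure_preserving_map) AE_iterate_total:
  assumes "dom T \<in> sets M" "AE \<omega> in M. \<omega> \<in> dom T" and \<tau>: "\<tau> = total T"
  shows "AE \<omega> in M. \<forall>n. iterate T n \<omega> = Some ((\<tau> ^^ n) \<omega>)"
proof -
  have "AE \<omega> in M. (\<tau> ^^ n) \<omega> \<in> dom T" for n
    by (rule AE_distrD[OF measurable_funpow_map], unfold distr_funpow) (rule assms(2))
  then have "AE \<omega> in M. \<forall>n. (\<tau> ^^ n) \<omega> \<in> dom T" by (simp add: AE_all_countable)
  then show ?thesis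
  proof eventually_elim
    fix \<omega> assume dom: "\<forall>n. (\<tau> ^^ n) \<omega> \<in> dom T"
    have "iterate T n \<omega> = Some ((\<tau> ^^ n) \<omega>)" for n
    proof (induction n)
      case (Suc n)
      obtain \<eta> where "T ((\<tau> ^^ n) \<omega>) = Some \<eta>" using dom by blast
      then have "T ((\<tau> ^^ n) \<omega>) = Some (\<tau> ((\<tau> ^^ n) \<omega>))" by (simp add: \<tau> total_def)
      with Suc show ?case by simp
    qed simp
    then show "\<forall>n. iterate T n \<omega> = Some ((\<tau> ^^ n) \<omega>)" ..
  qed
qed

theorem theorem7:
  fixes \<mu> :: "cantor measure" and T :: "cantor \<rightharpoonup> cantor" and A :: "cantor set"
  assumes "prob_space \<mu>" and "sets \<mu> = sets borel" and "computable_measure \<mu>"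
    and "partial_computable T" and "ae_defined \<mu> T"
    and "measure_preserving \<mu> T" and "ergodic \<mu> T"
    and "effectively_open A" and "measure \<mu> A < 1"
  shows "effectively_null \<mu> (always_in T A)"
proof -
  interpret prob_space \<mu> by fact
  have space: "space \<mu> = UNIV" using sets_eq_imp_space_eq[OF assms(2)] by simp
  interpret ergodic_map \<mu> "total T"
    by (rule ergodic_map_total) (use space assms in auto)
  obtain weight where weight: "recursive (\<lambda>n. weight (str_decode (p1 n)) (p2 n))"
    "\<And>x m. \<bar>2 ^ m * measure \<mu> (cyl x) - real (weight x m)\<bar> \<le> 2"
    using exists_weight[OF assms(3)] by blast
  obtain mach where mach: "\<And>\<omega> \<eta>. T \<omega> = Some \<eta> \<longleftrightarrow> outputs mach \<omega> \<eta>"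
    using assms(4) by (auto simp: partial_computable_def)
  obtain enum :: "nat \<Rightarrow> bool list option" where enum: "computable enum"
    "A = (\<Union>x\<in>{x. \<exists>t. enum t = Some x}. cyl x)"
    using assms(8) by (auto simp: effectively_open_def comp_enumerable_def)
  interpret computable_cover_construction mach enum weight
    by unfold_locales (use recursive_computable[OF enum(1), of "\<lambda>n. n"] weight(1) recursive_id
      in \<open>auto simp: encode_nat_def\<close>)
  interpret effective_ergodic_map \<mu> "total T" mach enum weight T A
    by unfold_locales (use assms(2,5) mach weight(2) enum(2) AE_iterate_total[of T]
      AE_prob_1[of "dom T"] in \<open>auto simp: ae_defined_def\<close>)
  \<comment> \<open>\<open>C\<close> is a constant built into the enumeration; its mere existence
    suffices, so no approximation of \<open>prob A\<close> is computed.\<close>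
  obtain C where C: "prob A ^ C < 1 / 2"
    using real_arch_pow_inv[of "1 / 2" "prob A"] assms(9) by auto
  \<comment> \<open>For the code of \<open>\<epsilon>\<close>, \<open>p2\<close> yields
    \<open>j = 2 * d\<close>, where \<open>d\<close> is the denominator. Then
    \<open>k = C * j\<close> makes the main term at most \<open>(1 / 2) ^ j\<close>; as
    \<open>k \<le> 2 ^ (C * j)\<close> and \<open>20 < 2 ^ 5\<close>, this choice of
    \<open>E\<close> keeps the error below the same bound.\<close>
  let ?k = "\<lambda>n. C * p2 n" and ?E = "\<lambda>n. C * p2 n + p2 n + 5"
  show ?thesis
    unfolding effectively_null_def
  proof (intro exI[of _ "\<lambda>\<epsilon> :: rat. level (?E (encode \<epsilon>)) (?k (encode \<epsilon>))"] conjI allI impI)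
    show "uniformly_comp_enumerable (\<lambda>\<epsilon> :: rat. level (?E (encode \<epsilon>)) (?k (encode \<epsilon>)))"
      by (rule uniformly_comp_enumerable_level) (intro recursive_intros)+
  next
    fix \<epsilon> :: rat
    show "always_in T A \<subseteq> (\<Union>x\<in>level (?E (encode \<epsilon>)) (?k (encode \<epsilon>)). cyl x)"
      using always_in_covered in_cyl_prefix_of by blast
  next
    fix \<epsilon> :: rat assume "0 < \<epsilon>"
    obtain a b where q: "quotient_of \<epsilon> = (a, b)" by (cases "quotient_of \<epsilon>")
    then have "0 < b" using quotient_of_denom_pos by blast
    have \<epsilon>: "\<epsilon> = of_int a / of_int b" using quotient_of_div[OF q] .
    with \<open>0 < \<epsilon>\<close> \<open>0 < b\<close> have "1 \<le> a" by (simp add: zero_less_divide_iff)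
    define d where "d = nat b"
    have "1 / real d \<le> of_rat \<epsilon>"
      using \<open>0 < b\<close> \<open>1 \<le> a\<close> by (simp add: \<epsilon> d_def of_rat_divide divide_right_mono)
    have j: "p2 (encode \<epsilon>) = 2 * d"
      using \<open>0 < b\<close> by (simp add: encode_rat_def q int_encode_def sum_encode_def d_def)
    let ?j = "2 * d"
    have "prob (\<Union>x\<in>level (?E (encode \<epsilon>)) (?k (encode \<epsilon>)). cyl x)
        \<le> prob A ^ (C * ?j) + real (C * ?j) * (20 / 2 ^ (C * ?j + ?j + 5))"
      using measure_level_le[of "?E (encode \<epsilon>)" "?k (encode \<epsilon>)"] unfolding j .
    also have "prob A ^ (C * ?j) \<le> (1 / 2) ^ ?j"
      unfolding power_mult[of "prob A" C ?j] using C by (intro power_mono) simp_all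
    also have "real (C * ?j) * (20 / 2 ^ (C * ?j + ?j + 5)) \<le> 2 ^ (C * ?j) * (20 / 2 ^ (C * ?j + ?j + 5))"
    proof (rule mult_right_mono)
      have "real (C * ?j) < real (2 ^ (C * ?j))" using less_exp by (simp only: of_nat_less_iff)
      then show "real (C * ?j) \<le> 2 ^ (C * ?j)" by simp
    qed simp
    also have "\<dots> = 20 / 32 * (1 / 2) ^ ?j"
      by (simp add: power_add power_divide)
    also have "(1 / 2) ^ ?j + 20 / 32 * (1 / 2) ^ ?j \<le> 2 * (1 / 2 :: real) ^ ?j" by simp
    also have "\<dots> \<le> 1 / real d"
    proof -
      have "real ?j < real (2 ^ ?j)" using less_exp by (simp only: of_nat_less_iff)
      moreover have "0 < d" using \<open>0 < b\<close> by (simp add: d_def)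
      ultimately show ?thesis by (simp add: power_divide field_simps)
    qed
    also note \<open>1 / real d \<le> of_rat \<epsilon>\<close>
    finally show "prob (\<Union>x\<in>level (?E (encode \<epsilon>)) (?k (encode \<epsilon>)). cyl x) \<le> of_rat \<epsilon>"
      by simp
  qed
qed

end
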